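(* Let $T:X\to X$ be a reiteratively hypercyclic adjoint operator on a separable dual Banach space $X$. Then for every $n\in\mathbb{N}$ the operator $T_n$ is reiteratively hypercyclic and frequently recurrent. In particular, the result holds whenever $T$ is a (reiteratively hypercyclic bounded linear) operator on a separable reflexive Banach space $X$.
   Context: Banach spaces may be real or complex. $\mathbb{N}=\{1,2,\dots\}$, $\mathbb{N}_0=\mathbb{N}\cup\{0\}$. "Adjoint operator on a separable dual Banach space" means: $X=Y^*$ is the dual of a Banach space $Y$, $X$ is norm-separable, and $T=S^*$ for some bounded linear operator $S:Y\to Y$. $T_n=T\oplus\cdots\oplus T$ ($n$ times) is the $n$-fold direct sum acting coordinatewise on $X^n=X\oplus\cdots\oplus X$ (with any norm defining the product topology). For an operator $S$, $N(x,A)=\{k\in\mathbb{N}_0: S^kx\in A\}$. For $A\subset\mathbb{N}_0$: $\underline{\operatorname{dens}}(A)=\liminf_{N\to\infty}\frac{\operatorname{card}(A\cap[0,N])}{N+1}$ and $\overline{\operatorname{Bd}}(A)=\limsup_{N\to\infty}\left(\max_{m\ge0}\frac{\operatorname{card}(A\cap[m,m+N])}{N+1}\right)$. $S$ is reiteratively hypercyclic if there is a vector $x$ with $\overline{\operatorname{Bd}}(N(x,U))>0$ for every non-empty open set $U$. $S$ is frequently recurrent if the set of vectors $x$ such that $\underline{\operatorname{dens}}(N(x,U))>0$ for every neighbourhood $U$ of $x$ is dense. *)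

theory Defs
  imports "HOL-Analysis.Analysis"
begin

section \<open>Normed spaces over the real or complex numbers\<close>

text \<open>
  The scalar field is a type \<open>'k\<close> of sort \<open>{real_normed_field, euclidean_space}\<close>.  Both \<open>real\<close> and
  \<open>complex\<close> have this sort, and every type of this sort is isometrically isomorphic, as a field,
  to one of them (a finite-dimensional field extension of the reals has degree 1 or 2, and its
  multiplicative norm is determined by the one on the reals).

  The library has no class of complex normed spaces.  A normed space over \<open>'k\<close> is therefore a type
  of class \<open>real_normed_vector\<close> (\<open>banach\<close> for a Banach space), which carries the norm and the
  underlying real structure, together with a scalar multiplication by \<open>'k\<close> that extends the real one
  and for which the norm is homogeneous.
\<close>

locale normed_space_over = vector_space smul
  for smul :: "'k::{real_normed_field,euclidean_space} \<Rightarrow> 'v::real_normed_vector \<Rightarrow> 'v" +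
  assumes smul_of_real: "smul (of_real r) x = r *\<^sub>R x"
    and norm_smul: "norm (smul c x) = norm c * norm x"

lemma normed_space_over_real_iff:
  "normed_space_over (smul :: real \<Rightarrow> 'v::real_normed_vector \<Rightarrow> 'v) \<longleftrightarrow> smul = scaleR"
proof
  assume "normed_space_over smul"
  then interpret normed_space_over smul .
  show "smul = scaleR"
    using smul_of_real by (intro ext) simp
next
  assume "smul = scaleR"
  then show "normed_space_over smul"
    by (simp add: normed_space_over_def normed_space_over_axioms_def real_vector.vector_space_axioms)
qed

lemma normed_space_over_scalars:
  "normed_space_over ((*) :: 'k \<Rightarrow> 'k \<Rightarrow> 'k::{real_normed_field,euclidean_space})"
  by unfold_locales (auto simp: algebra_simps norm_mult scaleR_conv_of_real)

definition bounded_operator ::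
  "('k::{real_normed_field,euclidean_space} \<Rightarrow> 'v::real_normed_vector \<Rightarrow> 'v) \<Rightarrow> ('v \<Rightarrow> 'v) \<Rightarrow> bool"
  where "bounded_operator smul S \<longleftrightarrow>
    Vector_Spaces.linear smul smul S \<and> (\<exists>C. \<forall>x. norm (S x) \<le> C * norm x)"

text \<open>
  The type \<open>'v \<Rightarrow>\<^sub>L 'k\<close> consists of the bounded real-linear maps with the operator norm; the dual is
  its subspace of \<open>'k\<close>-linear maps.
\<close>

definition dual_space ::
  "('k::{real_normed_field,euclidean_space} \<Rightarrow> 'v::real_normed_vector \<Rightarrow> 'v) \<Rightarrow> ('v \<Rightarrow>\<^sub>L 'k) set"
  where "dual_space smul = {f. Vector_Spaces.linear smul (*) (blinfun_apply f)}"

lemma dual_space_real: "dual_space (scaleR :: real \<Rightarrow> 'v::real_normed_vector \<Rightarrow> 'v) = UNIV"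
proof -
  have "Vector_Spaces.linear scaleR (*) (blinfun_apply f)" for f :: "'v \<Rightarrow>\<^sub>L real"
    unfolding Vector_Spaces.linear_def module_hom_def module_hom_axioms_def
    using real_vector.vector_space_axioms[where ?'a = 'v]
      real_vector.vector_space_axioms[where ?'a = real]
      real_vector.module_axioms[where ?'a = 'v] real_vector.module_axioms[where ?'a = real]
    by (simp add: real_scaleR_def[abs_def] blinfun.add_right blinfun.scaleR_right)
  then show ?thesis by (auto simp: dual_space_def)
qed

abbreviation dual_topology ::
  "('k::{real_normed_field,euclidean_space} \<Rightarrow> 'v::real_normed_vector \<Rightarrow> 'v) \<Rightarrow> ('v \<Rightarrow>\<^sub>L 'k) topology"
  where "dual_topology smul \<equiv> top_of_set (dual_space smul)"

text \<open>Only the values of \<open>T\<close> on the dual space matter; outside of it \<open>T\<close> is arbitrary.\<close>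

definition adjoint_operator ::
  "('k::{real_normed_field,euclidean_space} \<Rightarrow> 'v::real_normed_vector \<Rightarrow> 'v) \<Rightarrow>
    (('v \<Rightarrow>\<^sub>L 'k) \<Rightarrow> ('v \<Rightarrow>\<^sub>L 'k)) \<Rightarrow> bool"
  where "adjoint_operator smul T \<longleftrightarrow>
    (\<exists>S. bounded_operator smul S \<and>
      (\<forall>f\<in>dual_space smul. \<forall>y. blinfun_apply (T f) y = blinfun_apply f (S y)))"

text \<open>
  Surjectivity of the canonical embedding into the bidual.  A bounded functional on the dual space
  is given as a function on \<open>'v \<Rightarrow>\<^sub>L 'k\<close> of which only the values on \<open>dual_space smul\<close> matter;
  \<open>blinfun_mult_right c o\<^sub>L f\<close> is the scalar multiple of \<open>f\<close> by \<open>c\<close>.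
\<close>

definition bounded_functional_on_dual ::
  "('k::{real_normed_field,euclidean_space} \<Rightarrow> 'v::real_normed_vector \<Rightarrow> 'v) \<Rightarrow>
    (('v \<Rightarrow>\<^sub>L 'k) \<Rightarrow> 'k) \<Rightarrow> bool"
  where "bounded_functional_on_dual smul \<phi> \<longleftrightarrow>
    (\<forall>f\<in>dual_space smul. \<forall>g\<in>dual_space smul. \<phi> (f + g) = \<phi> f + \<phi> g) \<and>
    (\<forall>c. \<forall>f\<in>dual_space smul. \<phi> (blinfun_mult_right c o\<^sub>L f) = c * \<phi> f) \<and>
    (\<exists>C. \<forall>f\<in>dual_space smul. norm (\<phi> f) \<le> C * norm f)"

definition reflexive_space ::
  "('k::{real_normed_field,euclidean_space} \<Rightarrow> 'v::real_normed_vector \<Rightarrow> 'v) \<Rightarrow> bool"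
  where "reflexive_space smul \<longleftrightarrow>
    (\<forall>\<phi>. bounded_functional_on_dual smul \<phi> \<longrightarrow>
      (\<exists>x. \<forall>f\<in>dual_space smul. \<phi> f = blinfun_apply f x))"


section \<open>Densities and return sets\<close>

definition return_set :: "('a \<Rightarrow> 'a) \<Rightarrow> 'a \<Rightarrow> 'a set \<Rightarrow> nat set"
  where "return_set S x A = {k. (S ^^ k) x \<in> A}"

definition lower_density :: "nat set \<Rightarrow> ereal"
  where "lower_density A = liminf (\<lambda>N. ereal (real (card (A \<inter> {0..N})) / real (N + 1)))"

definition upper_Banach_density :: "nat set \<Rightarrow> ereal"
  where "upper_Banach_density A =
    limsup (\<lambda>N. ereal (Max (range (\<lambda>m. real (card (A \<inter> {m..m+N})) / real (N + 1)))))"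

text \<open>The maximum over \<open>m\<close> is one over finitely many values.\<close>

lemma finite_range_window_density:
  "finite (range (\<lambda>m. real (card (A \<inter> {m..m+N})) / real (N + 1)))"
proof (rule finite_subset)
  have "card (A \<inter> {m..m+N}) \<le> N + 1" for m
    using card_mono[of "{m..m+N}" "A \<inter> {m..m+N}"] by simp
  then show "range (\<lambda>m. real (card (A \<inter> {m..m+N})) / real (N + 1))
      \<subseteq> (\<lambda>k. real k / real (N + 1)) ` {..N + 1}"
    by blast
qed simp


section \<open>Dynamics\<close>

text \<open>
  The notions depend on the space only through its topology, so they are stated for an abstract
  topology: the norm topology of a Banach space or of a dual space, or a finite power of these.
\<close>

definition reiteratively_hypercyclic :: "'a topology \<Rightarrow> ('a \<Rightarrow> 'a) \<Rightarrow> bool"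
  where "reiteratively_hypercyclic X S \<longleftrightarrow>
    (\<exists>x\<in>topspace X. \<forall>U. openin X U \<and> U \<noteq> {} \<longrightarrow> upper_Banach_density (return_set S x U) > 0)"

definition neighbourhood_in :: "'a topology \<Rightarrow> 'a \<Rightarrow> 'a set \<Rightarrow> bool"
  where "neighbourhood_in X x U \<longleftrightarrow> U \<subseteq> topspace X \<and> (\<exists>V. openin X V \<and> x \<in> V \<and> V \<subseteq> U)"

definition frequently_recurrent :: "'a topology \<Rightarrow> ('a \<Rightarrow> 'a) \<Rightarrow> bool"
  where "frequently_recurrent X S \<longleftrightarrow>
    X closure_of {x \<in> topspace X. \<forall>U. neighbourhood_in X x U \<longrightarrow> lower_density (return_set S x U) > 0}
      = topspace X"

text \<open>
  Elements of the \<open>n\<close>-fold direct sum are functions on \<open>{..<n}\<close>, extended by \<open>undefined\<close>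
  as in \<open>product_topology\<close>.
\<close>

abbreviation power_topology :: "nat \<Rightarrow> 'a topology \<Rightarrow> (nat \<Rightarrow> 'a) topology"
  where "power_topology n X \<equiv> product_topology (\<lambda>_. X) {..<n}"

definition direct_sum_power :: "nat \<Rightarrow> ('a \<Rightarrow> 'a) \<Rightarrow> (nat \<Rightarrow> 'a) \<Rightarrow> (nat \<Rightarrow> 'a)"
  where "direct_sum_power n T v = (\<lambda>i\<in>{..<n}. T (v i))"

end

theory Submission
  imports Defs
begin

text \<open>
  Write \<open>X\<close> for the separable dual space and \<open>x\<close> for a reiteratively hypercyclic vector of \<open>T\<close>.  The
  proof combines a measure-theoretic and a purely combinatorial consequence of the fact that the orbit
  of \<open>x\<close> visits every open set with positive upper Banach density.

  \<^emph>\<open>Frequent recurrence.\<close>  Let \<open>B\<^sub>0, \<dots>, B\<^sub>n\<^sub>-\<^sub>1\<close> be balls of \<open>X\<close>.  For each \<open>j\<close> there are arbitrarily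
  long windows of times of which a fixed positive proportion is spent by the orbit of \<open>x\<close> in \<open>B\<^sub>j\<close>.  Draw
  \<open>n\<close> times independently and uniformly from such windows and let the windows grow: in the limit along
  an ultrafilter one obtains a finite measure which is invariant under advancing all times by one.
  A point of this measure space is a sequence of \<open>n\<close>-tuples of times; by weak* compactness of bounded
  sets the corresponding orbit points converge to a vector of \<open>X\<^sup>n\<close>, and since \<open>T\<close> is weak* continuous
  the shift of times becomes the action of \<open>T\<^sub>n\<close> on these vectors.  With positive measure the limit
  lies in the product of the closed balls.  In a finite measure-preserving system almost every
  point of a measurable set returns to it with positive lower density
  (\<open>recurrence_positive_frequency\<close>).  Closed balls are weak* closed, hence give measurable sets,
  and as \<open>X\<close> is norm separable countably many of them generate the norm topology; so almost every limit
  vector is frequently recurrent for \<open>T\<^sub>n\<close> in the norm topology (\<open>frequently_recurrent_point\<close>).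

  \<^emph>\<open>Transitivity.\<close>  The difference set of a set of positive upper Banach density meets every translate
  of a thick set.  As the times at which small vectors are carried close to \<open>x\<close> form a thick set, some
  single power \<open>T\<^sup>k\<close> maps a vector near \<open>x\<close> to a small vector and a small vector to one near \<open>x\<close>
  (\<open>small_orbit_pair\<close>).  Applying powers of \<open>T\<close> to these two vectors and adding them
  produces points that \<open>T\<^sub>n\<close> carries from any prescribed product of balls to any other
  (\<open>power_transitive\<close>), and Baire's theorem gives a vector with dense orbit under \<open>T\<^sub>n\<close>.

  A dense orbit follows the orbit of any given frequently recurrent vector during arbitrarily long
  windows.  Hence it visits every open set with positive upper Banach density, and \<open>T\<^sub>n\<close> is reiteratively
  hypercyclic (\<open>power_reiteratively_hypercyclic\<close>).

  The dual space enters only through the limits of bounded sequences and through the fact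
  that the norm is a supremum of weak* continuous functions.  These properties are collected in the locale
  \<open>adjoint_system\<close>; a reflexive space has them with respect to its own dual, by the theorem of Hahn
  and Banach.
\<close>

section \<open>Ultrafilters\<close>

definition ultrafilter :: "'a filter \<Rightarrow> bool"
  where "ultrafilter F \<longleftrightarrow> F \<noteq> bot \<and> (\<forall>P. eventually P F \<or> eventually (\<lambda>x. \<not> P x) F)"

lemma ultrafilter_not_bot: "ultrafilter F \<Longrightarrow> F \<noteq> bot"
  by (simp add: ultrafilter_def)

lemma ultrafilter_eventually_not:
  assumes "ultrafilter F" shows "eventually (\<lambda>x. \<not> P x) F \<longleftrightarrow> \<not> eventually P F"
  using assms eventually_happens'[of F "\<lambda>x. False"] eventually_conj[of P F "\<lambda>x. \<not> P x"]
  by (auto simp: ultrafilter_def)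

lemma ultrafilter_eventually_disj:
  assumes "ultrafilter F"
  shows "eventually (\<lambda>x. P x \<or> Q x) F \<longleftrightarrow> eventually P F \<or> eventually Q F"
  using ultrafilter_eventually_not[OF assms, of "\<lambda>x. P x \<or> Q x"]
    ultrafilter_eventually_not[OF assms, of P] ultrafilter_eventually_not[OF assms, of Q]
  by (simp add: eventually_conj_iff) blast

text \<open>
  A proper filter that is minimal below \<open>G\<close> decides every predicate: otherwise it could be refined by
  that predicate.
\<close>

lemma ultrafilter_below:
  fixes G :: "'a filter"
  assumes "G \<noteq> bot"
  obtains F where "ultrafilter F" "F \<le> G"
proof -
  define \<A> where "\<A> = {F. F \<noteq> bot \<and> F \<le> G}"
  have "\<exists>F\<in>\<A>. \<forall>H\<in>\<A>. F \<ge> H \<longrightarrow> H = F"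
  proof (rule predicate_Zorn)
    show "partial_order_on \<A> (relation_of (\<ge>) \<A>)"
      by (rule partial_order_on_relation_ofI) auto
    fix C assume C: "C \<in> Chains (relation_of (\<ge>) \<A>)"
    show "\<exists>u\<in>\<A>. \<forall>a\<in>C. u \<le> a"
    proof (cases "C = {}")
      case True
      then show ?thesis using assms by (auto simp: \<A>_def)
    next
      case False
      have sub: "C \<subseteq> \<A>" using Chains_relation_of[OF C] .
      have lin: "a \<le> b \<or> b \<le> a" if "a \<in> C" "b \<in> C" for a b
        using C that by (auto simp: Chains_def relation_of_def)
      have "eventually P (Inf C) \<longleftrightarrow> (\<exists>b\<in>C. eventually P b)" for P
        using False by (intro eventually_Inf_base) (use lin in force)+
      then have "Inf C \<noteq> bot"
        using sub by (auto simp: trivial_limit_def \<A>_def)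
      moreover have "Inf C \<le> G"
        using False sub by (auto simp: \<A>_def intro: Inf_lower2)
      ultimately show ?thesis
        by (intro bexI[of _ "Inf C"]) (auto simp: \<A>_def Inf_lower)
    qed
  qed
  then obtain F where F: "F \<in> \<A>" and min: "\<And>H. H \<in> \<A> \<Longrightarrow> H \<le> F \<Longrightarrow> H = F" by blast
  have "ultrafilter F"
    unfolding ultrafilter_def
  proof (intro conjI allI)
    show "F \<noteq> bot" using F by (simp add: \<A>_def)
    fix P
    show "eventually P F \<or> (\<forall>\<^sub>F x in F. \<not> P x)"
    proof (rule disjCI)
      assume *: "\<not> (\<forall>\<^sub>F x in F. \<not> P x)"
      let ?H = "inf F (principal {x. P x})"
      have "?H \<noteq> bot"
        using * by (simp add: trivial_limit_def eventually_inf_principal)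
      then have "?H = F"
        using F by (intro min) (auto simp: \<A>_def intro: le_infI1)
      moreover have "eventually P ?H"
        by (simp add: eventually_inf_principal)
      ultimately show "eventually P F" by simp
    qed
  qed
  with F that show thesis by (auto simp: \<A>_def)
qed

text \<open>
  If no point of \<open>K\<close> were a limit, each would have a neighbourhood that \<open>f\<close> eventually avoids, and a finite
  subcover would make \<open>f\<close> avoid \<open>K\<close> altogether.
\<close>

lemma ultrafilter_tendsto_compact:
  fixes f :: "'a \<Rightarrow> 'b::topological_space"
  assumes F: "ultrafilter F" and K: "compact K" and f: "eventually (\<lambda>i. f i \<in> K) F"
  shows "\<exists>l\<in>K. (f \<longlongrightarrow> l) F"
proof (rule ccontr)
  assume no: "\<not> ?thesis"
  have "\<exists>S. open S \<and> l \<in> S \<and> eventually (\<lambda>i. f i \<notin> S) F" if "l \<in> K" for l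
    using no that ultrafilter_eventually_not[OF F] unfolding tendsto_def by blast
  then obtain S where S: "\<And>l. l \<in> K \<Longrightarrow> open (S l) \<and> l \<in> S l \<and> eventually (\<lambda>i. f i \<notin> S l) F"
    by metis
  obtain L where L: "L \<subseteq> K" "finite L" "K \<subseteq> (\<Union>l\<in>L. S l)"
    using compactE_image[OF K, of K S] S by blast
  have "eventually (\<lambda>i. \<forall>l\<in>L. f i \<notin> S l) F"
    using L S by (intro eventually_ball_finite) auto
  with f have "eventually (\<lambda>i. False) F"
    by eventually_elim (use L in auto)
  then show False using F by (simp add: ultrafilter_def)
qed

lemma ultrafilter_tendsto_bounded:
  fixes f :: "'a \<Rightarrow> 'b::euclidean_space"
  assumes "ultrafilter F" "eventually (\<lambda>i. norm (f i) \<le> C) F"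
  obtains l where "norm l \<le> C" "(f \<longlongrightarrow> l) F"
proof -
  have "eventually (\<lambda>i. f i \<in> cball 0 C) F" using assms(2) by simp
  from ultrafilter_tendsto_compact[OF assms(1) compact_cball this] show thesis
    using that by (metis mem_cball_0)
qed

section \<open>The Loeb measure of a sequence of finite windows\<close>

text \<open>
  A time is drawn uniformly from each window \<open>W i\<close>.  The limit of these experiments along an ultrafilter
  is a measure on the space of sequences of times, for which the events of the form ``\<open>k i \<in> A i\<close> for
  almost all \<open>i\<close>'' have as probability the limit of the proportions of \<open>A i\<close> in \<open>W i\<close>.  Building the
  measure on sequences of times, rather than on a space of vectors, makes its countable additivity a
  matter of choosing sequences.
\<close>

locale loeb_windows =
  fixes F :: "nat filter" and W :: "nat \<Rightarrow> 'a set"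
  assumes ultra: "ultrafilter F" and free: "F \<le> sequentially"
    and finite_W: "\<And>i. finite (W i)" and W_ne: "\<And>i. W i \<noteq> {}"
begin

definition internal :: "(nat \<Rightarrow> 'a set) \<Rightarrow> (nat \<Rightarrow> 'a) set"
  where "internal A = {k. eventually (\<lambda>i. k i \<in> A i) F}"

definition ratio :: "'a set \<Rightarrow> nat \<Rightarrow> real"
  where "ratio A i = real (card (A \<inter> W i)) / real (card (W i))"

definition limit_ratio :: "(nat \<Rightarrow> 'a set) \<Rightarrow> real"
  where "limit_ratio A = Lim F (\<lambda>i. ratio (A i) i)"

lemma card_W_pos: "0 < real (card (W i))"
  using finite_W W_ne by (simp add: card_gt_0_iff)

lemma ratio_nonneg: "0 \<le> ratio A i" and ratio_le_1: "ratio A i \<le> 1"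
proof -
  have "card (A \<inter> W i) \<le> card (W i)" using finite_W by (intro card_mono) auto
  then show "0 \<le> ratio A i" "ratio A i \<le> 1"
    using card_W_pos[of i] by (auto simp: ratio_def)
qed

lemma limit_ratio_tendsto: "((\<lambda>i. ratio (A i) i) \<longlongrightarrow> limit_ratio A) F"
proof -
  obtain l where l: "((\<lambda>i. ratio (A i) i) \<longlongrightarrow> l) F"
    using ultrafilter_tendsto_bounded[OF ultra always_eventually, of "\<lambda>i. ratio (A i) i" 1]
    by (simp add: ratio_nonneg ratio_le_1) blast
  have "limit_ratio A = l"
    unfolding limit_ratio_def by (rule tendsto_Lim[OF ultrafilter_not_bot[OF ultra] l])
  then show ?thesis using l by simp
qed

lemma limit_ratio_unique: "((\<lambda>i. ratio (A i) i) \<longlongrightarrow> l) F \<Longrightarrow> limit_ratio A = l"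
  using limit_ratio_tendsto tendsto_unique ultrafilter_not_bot[OF ultra] by blast

lemma limit_ratio_ge:
  assumes "eventually (\<lambda>i. c \<le> ratio (A i) i) F"
  shows "c \<le> limit_ratio A"
  using tendsto_lowerbound[OF limit_ratio_tendsto assms ultrafilter_not_bot[OF ultra]] .

lemma limit_ratio_nonneg: "0 \<le> limit_ratio A"
  by (rule limit_ratio_ge) (simp add: ratio_nonneg)

text \<open>
  A sequence in \<open>internal A\<close> may be altered at every index where \<open>A i\<close> is not contained in \<open>B i\<close> so as to
  leave \<open>B i\<close>.
\<close>

lemma internal_subset_or_empty_iff: "internal A \<subseteq> internal B \<longleftrightarrow> eventually (\<lambda>i. A i \<subseteq> B i) F \<or> internal A = {}"
proof
  assume sub: "internal A \<subseteq> internal B"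
  show "eventually (\<lambda>i. A i \<subseteq> B i) F \<or> internal A = {}"
  proof (rule disjCI, rule ccontr)
    assume "internal A \<noteq> {}" and n: "\<not> eventually (\<lambda>i. A i \<subseteq> B i) F"
    then obtain k where k: "eventually (\<lambda>i. k i \<in> A i) F" by (auto simp: internal_def)
    define k' where "k' i = (if A i \<subseteq> B i then k i else SOME a. a \<in> A i - B i)" for i
    have ev: "eventually (\<lambda>i. \<not> A i \<subseteq> B i) F" using n ultrafilter_eventually_not[OF ultra] by blast
    have *: "k' i \<in> A i - B i" if "\<not> A i \<subseteq> B i" for i
      using that some_in_eq[of "A i - B i"] by (auto simp: k'_def)
    have "k' \<in> internal A"
      unfolding internal_def mem_Collect_eq using ev by eventually_elim (use * in auto)
    moreover have "eventually (\<lambda>i. k' i \<notin> B i) F"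
      using ev by eventually_elim (use * in auto)
    ultimately show False
      using sub ultrafilter_eventually_not[OF ultra] by (auto simp: internal_def)
  qed
next
  assume "eventually (\<lambda>i. A i \<subseteq> B i) F \<or> internal A = {}"
  then show "internal A \<subseteq> internal B"
  proof
    assume *: "eventually (\<lambda>i. A i \<subseteq> B i) F"
    show ?thesis
    proof
      fix k assume "k \<in> internal A"
      then show "k \<in> internal B"
        unfolding internal_def mem_Collect_eq using * by eventually_elim auto
    qed
  qed simp
qed

lemma internal_empty_iff: "internal A = {} \<longleftrightarrow> eventually (\<lambda>i. A i = {}) F"
proof
  assume e: "internal A = {}"
  show "eventually (\<lambda>i. A i = {}) F"
  proof (rule ccontr)
    assume "\<not> ?thesis"
    then have "eventually (\<lambda>i. A i \<noteq> {}) F"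
      using ultrafilter_eventually_not[OF ultra] by blast
    then have "eventually (\<lambda>i. (SOME a. a \<in> A i) \<in> A i) F"
      by eventually_elim (simp add: some_in_eq)
    then show False using e by (auto simp: internal_def)
  qed
next
  assume *: "eventually (\<lambda>i. A i = {}) F"
  { fix k assume "k \<in> internal A"
    then have "eventually (\<lambda>i. k i \<in> A i) F" by (simp add: internal_def)
    with * have "eventually (\<lambda>i. False) F" by eventually_elim auto
    then have False using ultrafilter_not_bot[OF ultra] by simp }
  then show "internal A = {}" by blast
qed

lemma internal_subset_iff: "internal A \<subseteq> internal B \<longleftrightarrow> eventually (\<lambda>i. A i \<subseteq> B i) F"
proof -
  have "eventually (\<lambda>i. A i \<subseteq> B i) F" if "eventually (\<lambda>i. A i = {}) F"
    using that by eventually_elim auto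
  then show ?thesis by (auto simp: internal_subset_or_empty_iff internal_empty_iff)
qed

lemma limit_ratio_cong:
  assumes "internal A = internal B" shows "limit_ratio A = limit_ratio B"
proof (rule limit_ratio_unique)
  have "eventually (\<lambda>i. A i \<subseteq> B i) F" "eventually (\<lambda>i. B i \<subseteq> A i) F"
    using assms internal_subset_iff by blast+
  then have "eventually (\<lambda>i. ratio (B i) i = ratio (A i) i) F"
  proof eventually_elim
    case (elim i)
    then have "A i = B i" by blast
    then show ?case by simp
  qed
  then show "((\<lambda>i. ratio (A i) i) \<longlongrightarrow> limit_ratio B) F"
    by (rule Lim_transform_eventually[OF limit_ratio_tendsto])
qed

lemma internal_Compl: "internal (\<lambda>i. - A i) = - internal A"
  using ultrafilter_eventually_not[OF ultra] by (auto simp: internal_def)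

lemma internal_Un: "internal (\<lambda>i. A i \<union> B i) = internal A \<union> internal B"
  using ultrafilter_eventually_disj[OF ultra] by (auto simp: internal_def)

lemma internal_Int: "internal (\<lambda>i. A i \<inter> B i) = internal A \<inter> internal B"
  by (auto simp: internal_def eventually_conj_iff)

lemma internal_empty: "internal (\<lambda>i. {}) = {}"
  using ultrafilter_not_bot[OF ultra] by (simp add: internal_def)

lemma internal_UNIV: "internal (\<lambda>i. UNIV) = UNIV"
  by (simp add: internal_def)

lemma limit_ratio_Un:
  assumes "internal A \<inter> internal B = {}"
  shows "limit_ratio (\<lambda>i. A i \<union> B i) = limit_ratio A + limit_ratio B"
proof (rule limit_ratio_unique)
  have "eventually (\<lambda>i. A i \<inter> B i = {}) F"
    using assms internal_Int[of A B] internal_empty_iff by metis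
  then have ev: "eventually (\<lambda>i. ratio (A i) i + ratio (B i) i = ratio (A i \<union> B i) i) F"
  proof eventually_elim
    case (elim i)
    have "card ((A i \<union> B i) \<inter> W i) = card (A i \<inter> W i) + card (B i \<inter> W i)"
      using elim finite_W by (subst card_Un_disjoint[symmetric]) (auto simp: Int_Un_distrib2)
    then show ?case by (simp add: ratio_def add_divide_distrib)
  qed
  show "((\<lambda>i. ratio (A i \<union> B i) i) \<longlongrightarrow> limit_ratio A + limit_ratio B) F"
    by (rule Lim_transform_eventually[OF tendsto_add[OF limit_ratio_tendsto limit_ratio_tendsto] ev])
qed

text \<open>
  A diagonal choice: at index \<open>i\<close> pick a point in as many of the first \<open>i\<close> sets as possible.  For every
  \<open>n\<close>, almost all indices allow the first \<open>n\<close> sets.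
\<close>

lemma internal_saturated:
  fixes A :: "nat \<Rightarrow> nat \<Rightarrow> 'a set"
  assumes dec: "decseq (\<lambda>n. internal (A n))" and ne: "\<And>n. internal (A n) \<noteq> {}"
  shows "(\<Inter>n. internal (A n)) \<noteq> {}"
proof -
  define C where "C n i = (\<Inter>m\<le>n. A m i)" for n i
  have C: "internal (C n) = internal (A n)" for n
  proof
    show "internal (C n) \<subseteq> internal (A n)"
      unfolding internal_subset_iff by (rule always_eventually) (auto simp: C_def)
    have "eventually (\<lambda>i. \<forall>m\<in>{..n}. A n i \<subseteq> A m i) F"
      using dec by (intro eventually_ball_finite)
        (auto simp: internal_subset_iff[symmetric] decseq_def)
    then show "internal (A n) \<subseteq> internal (C n)"
      unfolding internal_subset_iff by eventually_elim (auto simp: C_def)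
  qed
  have C_ne: "eventually (\<lambda>i. C n i \<noteq> {}) F" for n
    using ne[of n] ultrafilter_eventually_not[OF ultra] C internal_empty_iff by metis
  define h where "h i = Max {n. n \<le> i \<and> C n i \<noteq> {}}" for i
  define k where "k i = (SOME a. a \<in> C (h i) i)" for i
  have "k \<in> internal (A n)" for n
  proof -
    have "eventually (\<lambda>i. n \<le> i) F"
      using free eventually_ge_at_top filter_leD by blast
    with C_ne[of n] have "eventually (\<lambda>i. k i \<in> A n i) F"
    proof eventually_elim
      case (elim i)
      let ?S = "{n. n \<le> i \<and> C n i \<noteq> {}}"
      have fin: "finite ?S" by simp
      have n: "n \<in> ?S" using elim by simp
      have "h i \<in> ?S" unfolding h_def using fin n by (intro Max_in) blast+
      then have k: "k i \<in> C (h i) i" by (simp add: k_def some_in_eq)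
      have "n \<le> h i" unfolding h_def using fin n by (intro Max_ge)
      then show ?case using k by (auto simp: C_def)
    qed
    then show ?thesis by (simp add: internal_def)
  qed
  then show ?thesis by blast
qed

lemma algebra_internal: "algebra UNIV (range internal)"
  unfolding algebra_iff_Un
proof (intro conjI ballI)
  show "{} \<in> range internal" by (rule range_eqI[where x="\<lambda>i. {}"]) (simp add: internal_empty)
  show "UNIV - a \<in> range internal" if "a \<in> range internal" for a
    using that by (auto simp: internal_Compl[symmetric] Compl_eq_Diff_UNIV[symmetric])
  show "a \<union> b \<in> range internal" if "a \<in> range internal" "b \<in> range internal" for a b
    using that by (auto simp: internal_Un[symmetric])
qed simp

text \<open>
  The value depends only on the event, not on the sequence chosen to represent it, by \<open>limit_ratio_cong\<close>.
\<close>

definition content :: "(nat \<Rightarrow> 'a) set \<Rightarrow> ennreal"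
  where "content S = ennreal (limit_ratio (SOME A. internal A = S))"

lemma content_internal: "content (internal A) = ennreal (limit_ratio A)"
proof -
  have "internal (SOME B. internal B = internal A) = internal A"
    by (rule someI[of "\<lambda>B. internal B = internal A" A]) (rule refl)
  then show ?thesis unfolding content_def using limit_ratio_cong by metis
qed

text \<open>
  Continuity at the empty set is trivial: by saturation a decreasing sequence of internal sets with
  empty intersection is eventually empty.
\<close>

lemma ex_loeb:
  "\<exists>\<mu>. (\<forall>s\<in>range internal. \<mu> s = content s) \<and> measure_space UNIV (sigma_sets UNIV (range internal)) \<mu>"
proof -
  interpret algebra UNIV "range internal" by (rule algebra_internal)
  show ?thesis
  proof (rule caratheodory_empty_continuous)
    have "limit_ratio (\<lambda>i. {}) = 0"
      by (rule limit_ratio_unique) (simp add: ratio_def)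
    then show "positive (range internal) content"
      using content_internal[of "\<lambda>i. {}"] internal_empty by (simp add: positive_def)
    show "additive (range internal) content"
      unfolding additive_def
    proof (intro ballI impI)
      fix x y assume xy: "x \<in> range internal" "y \<in> range internal" "x \<inter> y = {}"
      then obtain A B where AB: "x = internal A" "y = internal B" by blast
      then have "content (x \<union> y) = ennreal (limit_ratio (\<lambda>i. A i \<union> B i))"
        using content_internal internal_Un by metis
      then show "content (x \<union> y) = content x + content y"
        using xy(3) by (simp add: AB content_internal limit_ratio_Un limit_ratio_nonneg)
    qed
    show "content A \<noteq> \<infinity>" for A by (simp add: content_def)
    fix A :: "nat \<Rightarrow> (nat \<Rightarrow> 'a) set"
    assume A: "range A \<subseteq> range internal" "decseq A" "\<Inter> (range A) = {}"
    then have "\<forall>n. \<exists>B. A n = internal B" by blast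
    then obtain B where B: "\<And>n. A n = internal (B n)" by metis
    have "decseq (\<lambda>n. internal (B n))" "(\<Inter>n. internal (B n)) = {}"
      using A(2,3) B by (auto simp: decseq_def)
    then obtain n where n: "A n = {}"
      using internal_saturated[of B] B by metis
    have "content (A m) = 0" if "m \<ge> n" for m
    proof -
      have "A m = {}" using n that decseqD[OF A(2) that] by blast
      then show ?thesis using \<open>positive (range internal) content\<close> by (simp add: positive_def)
    qed
    then show "(\<lambda>i. content (A i)) \<longlonglongrightarrow> 0"
      by (intro tendsto_eventually eventually_sequentiallyI[of n])
  qed
qed

definition loeb :: "(nat \<Rightarrow> 'a) measure"
  where "loeb = measure_of UNIV (range internal)
    (SOME \<mu>. (\<forall>s\<in>range internal. \<mu> s = content s) \<and>
      measure_space UNIV (sigma_sets UNIV (range internal)) \<mu>)"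

lemma space_loeb [simp]: "space loeb = UNIV"
  by (simp add: loeb_def)

lemma sets_loeb: "sets loeb = sigma_sets UNIV (range internal)"
  by (simp add: loeb_def)

lemma internal_in_sets [measurable]: "internal A \<in> sets loeb"
  by (auto simp: sets_loeb)

lemma emeasure_loeb: "emeasure loeb (internal A) = ennreal (limit_ratio A)"
proof -
  let ?P = "\<lambda>\<mu>. (\<forall>s\<in>range internal. \<mu> s = content s) \<and>
      measure_space UNIV (sigma_sets UNIV (range internal)) \<mu>"
  have P: "?P (SOME \<mu>. ?P \<mu>)" by (rule someI_ex[OF ex_loeb])
  have "emeasure loeb (internal A) = (SOME \<mu>. ?P \<mu>) (internal A)"
    by (rule emeasure_measure_of[OF loeb_def])
      (use P in \<open>auto simp: measure_space_def sets_loeb\<close>)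
  then show ?thesis using P content_internal by simp
qed

lemma finite_measure_loeb: "finite_measure loeb"
  using emeasure_loeb[of "\<lambda>i. UNIV"] internal_UNIV by (intro finite_measureI) simp

text \<open>
  By injectivity the preimage of \<open>A\<close> has as many points in \<open>W i\<close> as \<open>A\<close> has in \<open>s ` W i\<close>, so moving by \<open>s\<close>
  changes the proportion of \<open>A\<close> by at most that of the boundary of the window.
\<close>

lemma loeb_shift_invariant:
  assumes inj: "inj s"
    and folner: "(\<lambda>i. real (card (W i - s ` W i)) / real (card (W i))) \<longlonglongrightarrow> 0"
  shows "(\<lambda>k i. s (k i)) \<in> measurable loeb loeb"
    and "distr loeb loeb (\<lambda>k i. s (k i)) = loeb"
proof -
  let ?S = "\<lambda>k i. s (k i)"
  have pre: "?S -` internal A = internal (\<lambda>i. s -` A i)" for A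
    by (auto simp: internal_def)
  have "?S \<in> measurable loeb (sigma UNIV (range internal))"
    by (rule measurable_measure_of) (auto simp: pre)
  then show meas: "?S \<in> measurable loeb loeb"
    by (simp add: measurable_def sets_loeb)
  have dens: "limit_ratio (\<lambda>i. s -` A i) = limit_ratio A" for A
  proof (rule limit_ratio_unique)
    let ?r = "\<lambda>i. real (card (W i - s ` W i)) / real (card (W i))"
    have "\<bar>ratio (s -` A i) i - ratio (A i) i\<bar> \<le> ?r i" for i
    proof -
      have f: "finite (W i)" "finite (s ` W i)" using finite_W by auto
      have img: "card (s -` A i \<inter> W i) = card (A i \<inter> s ` W i)"
      proof -
        have "s ` (s -` A i \<inter> W i) = A i \<inter> s ` W i" by auto
        then show ?thesis using card_image[of s "s -` A i \<inter> W i"] inj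
          by (metis inj_on_subset subset_UNIV)
      qed
      have cs: "card (s ` W i) = card (W i)"
        using inj by (metis card_image inj_on_subset subset_UNIV)
      have e: "card (s ` W i - W i) = card (W i - s ` W i)"
        using f cs by (metis (no_types, lifting) Int_commute card_Diff_subset_Int finite_Int)
      have "card (A i \<inter> s ` W i) \<le> card (A i \<inter> W i \<union> (s ` W i - W i))"
        using f by (intro card_mono) auto
      also have "\<dots> \<le> card (A i \<inter> W i) + card (s ` W i - W i)" by (rule card_Un_le)
      finally have 1: "card (A i \<inter> s ` W i) \<le> card (A i \<inter> W i) + card (W i - s ` W i)"
        using e by simp
      have "card (A i \<inter> W i) \<le> card (A i \<inter> s ` W i \<union> (W i - s ` W i))"
        using f by (intro card_mono) auto
      also have "\<dots> \<le> card (A i \<inter> s ` W i) + card (W i - s ` W i)" by (rule card_Un_le)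
      finally have 2: "card (A i \<inter> W i) \<le> card (A i \<inter> s ` W i) + card (W i - s ` W i)" .
      have "\<bar>real (card (A i \<inter> s ` W i)) - real (card (A i \<inter> W i))\<bar> \<le> real (card (W i - s ` W i))"
        using 1 2 by linarith
      then show ?thesis
        using card_W_pos[of i] unfolding ratio_def img
        by (simp add: diff_divide_distrib[symmetric] abs_div divide_right_mono)
    qed
    then have "((\<lambda>i. ratio (s -` A i) i - ratio (A i) i) \<longlongrightarrow> 0) F"
      by (intro Lim_null_comparison[OF always_eventually tendsto_mono[OF free folner]]) simp
    from tendsto_add[OF this limit_ratio_tendsto[of A]]
    show "((\<lambda>i. ratio (s -` A i) i) \<longlongrightarrow> limit_ratio A) F" by simp
  qed
  show "distr loeb loeb ?S = loeb"
  proof (rule measure_eqI_generator_eq[where A="\<lambda>_. UNIV" and \<Omega>=UNIV and E="range internal"])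
    show "Int_stable (range internal)"
      by (auto simp: Int_stable_def internal_Int[symmetric])
    show "emeasure (distr loeb loeb ?S) X = emeasure loeb X" if "X \<in> range internal" for X
      using that meas pre dens by (auto simp: emeasure_distr emeasure_loeb)
    show "range (\<lambda>_::nat. UNIV) \<subseteq> range internal"
      by (auto intro!: range_eqI[where x="\<lambda>i. UNIV"] simp: internal_UNIV)
    show "emeasure (distr loeb loeb ?S) UNIV \<noteq> \<infinity>" for i :: nat
      using finite_measure.emeasure_finite[OF finite_measure_loeb, of UNIV]
        emeasure_distr[OF meas, of UNIV] sets.top[of loeb] by simp
  qed (auto simp: sets_loeb)
qed

end

section \<open>Densities\<close>

lemma lower_density_posI:
  assumes "0 < c" and "\<And>N. c * real (N + 1) \<le> real (card (A \<inter> {0..N}))"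
  shows "0 < lower_density A"
proof -
  have "ereal c \<le> lower_density A"
    unfolding lower_density_def
    by (rule Liminf_bounded) (use assms in \<open>simp add: field_simps\<close>)
  then show ?thesis using assms(1) by (simp add: less_le_trans[of 0 "ereal c"])
qed

lemma lower_density_mono:
  assumes "A \<subseteq> B" shows "lower_density A \<le> lower_density B"
  unfolding lower_density_def
proof (rule Liminf_mono, rule always_eventually, rule allI)
  fix N
  have "card (A \<inter> {0..N}) \<le> card (B \<inter> {0..N})" using assms by (intro card_mono) auto
  then show "ereal (real (card (A \<inter> {0..N})) / real (N + 1))
      \<le> ereal (real (card (B \<inter> {0..N})) / real (N + 1))"
    by (simp add: divide_right_mono)
qed

text \<open>
  Positivity is a statement about arbitrarily long windows of a fixed relative density; all arguments
  below use it in this form.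
\<close>

lemma upper_Banach_density_pos_iff:
  "0 < upper_Banach_density A \<longleftrightarrow>
    (\<exists>\<delta>>0. \<forall>L. \<exists>N\<ge>L. \<exists>m. \<delta> * real (N + 1) \<le> real (card (A \<inter> {m..m+N})))"
  (is "_ \<longleftrightarrow> ?R")
proof
  let ?X = "\<lambda>N. Max (range (\<lambda>m. real (card (A \<inter> {m..m+N})) / real (N + 1)))"
  assume pos: "0 < upper_Banach_density A"
  obtain \<delta> where \<delta>: "0 < ereal \<delta>" "ereal \<delta> < upper_Banach_density A"
    using ereal_dense2[OF pos] by blast
  have ex_N: "\<exists>N\<ge>L. \<delta> \<le> ?X N" for L
  proof (rule ccontr)
    assume "\<not> ?thesis"
    then have "eventually (\<lambda>N. ereal (?X N) \<le> ereal \<delta>) sequentially"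
      by (intro eventually_sequentiallyI[of L]) force
    from Limsup_bounded[OF this] \<delta>(2) show False
      by (simp add: upper_Banach_density_def)
  qed
  have ex_m: "\<exists>m. ?X N = real (card (A \<inter> {m..m+N})) / real (N + 1)" for N
    using Max_in[OF finite_range_window_density[of A N]] by blast
  have "\<exists>N\<ge>L. \<exists>m. \<delta> * real (N + 1) \<le> real (card (A \<inter> {m..m+N}))" for L
  proof -
    obtain N where N: "N \<ge> L" "\<delta> \<le> ?X N" using ex_N by blast
    obtain m where "?X N = real (card (A \<inter> {m..m+N})) / real (N + 1)" using ex_m by blast
    with N(2) have "\<delta> \<le> real (card (A \<inter> {m..m+N})) / real (N + 1)" by (simp only:)
    then have "\<delta> * real (N + 1) \<le> real (card (A \<inter> {m..m+N}))"
      by (subst (asm) pos_le_divide_eq) simp_all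
    then show ?thesis using N(1) by blast
  qed
  then show ?R using \<delta>(1) by auto
next
  assume ?R
  then obtain \<delta> where \<delta>: "\<delta> > 0"
    and w: "\<And>L. \<exists>N\<ge>L. \<exists>m. \<delta> * real (N + 1) \<le> real (card (A \<inter> {m..m+N}))" by blast
  have "ereal \<delta> \<le> upper_Banach_density A"
    unfolding upper_Banach_density_def limsup_INF_SUP
  proof (rule INF_greatest)
    fix L :: nat
    obtain N m where N: "N \<ge> L" and m: "\<delta> * real (N + 1) \<le> real (card (A \<inter> {m..m+N}))"
      using w by blast
    have "\<delta> \<le> real (card (A \<inter> {m..m+N})) / real (N + 1)"
      using m by (subst pos_le_divide_eq) simp_all
    also have "\<dots> \<le> Max (range (\<lambda>m. real (card (A \<inter> {m..m+N})) / real (N + 1)))"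
      by (rule Max_ge[OF finite_range_window_density]) blast
    finally show "ereal \<delta> \<le> (SUP N\<in>{L..}. ereal (Max (range (\<lambda>m. real (card (A \<inter> {m..m+N})) / real (N + 1)))))"
      using N by (intro SUP_upper2[of N]) auto
  qed
  then show "0 < upper_Banach_density A" using \<delta> by (simp add: less_le_trans[of 0 "ereal \<delta>"])
qed

lemma lower_density_pos_imp_upper_Banach_density_pos:
  assumes "0 < lower_density A" shows "0 < upper_Banach_density A"
proof -
  obtain \<delta> where \<delta>: "0 < ereal \<delta>" "ereal \<delta> < lower_density A"
    using ereal_dense2[OF assms] by blast
  then have "eventually (\<lambda>N. ereal \<delta> < ereal (real (card (A \<inter> {0..N})) / real (N + 1))) sequentially"
    unfolding lower_density_def by (intro less_LiminfD)
  then obtain N0 where N0: "\<And>N. N \<ge> N0 \<Longrightarrow> \<delta> < real (card (A \<inter> {0..N})) / real (N + 1)"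
    by (auto simp: eventually_sequentially)
  show ?thesis
    unfolding upper_Banach_density_pos_iff
  proof (intro exI[of _ \<delta>] conjI allI)
    show "0 < \<delta>" using \<delta> by simp
    fix L
    show "\<exists>N\<ge>L. \<exists>m. \<delta> * real (N + 1) \<le> real (card (A \<inter> {m..m+N}))"
    proof (intro exI conjI)
      let ?N = "max L N0"
      have "\<delta> < real (card (A \<inter> {0..0 + ?N})) / real (?N + 1)"
        using N0[of ?N] by simp
      then show "\<delta> * real (?N + 1) \<le> real (card (A \<inter> {0..0 + ?N}))"
        by (subst (asm) pos_less_divide_eq) simp_all
    qed simp
  qed
qed

section \<open>Recurrence in finite measure-preserving systems\<close>

lemma sum_lessThan_add: "(\<Sum>t<n+m. f t) = (\<Sum>t<n. f t) + (\<Sum>t<m. f (n + t))"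
  for f :: "nat \<Rightarrow> 'a::comm_monoid_add"
  by (induction m) (auto simp: add.assoc)

lemma funpow_apply_add: "(S ^^ (n + t)) w = (S ^^ t) ((S ^^ n) w)"
  by (simp only: add.commute[of n t] funpow_add comp_apply)

text \<open>
  Cut the orbit segment greedily from the left.  A point of \<open>Z - B\<close> starts a block of length at most
  \<open>K\<close> with at most the fraction \<open>e\<close> of its points in \<open>V\<close>; any other point is a block by itself, which
  contributes only if it lies in \<open>B\<close>.  The term \<open>K\<close> pays for the unfinished last block.
\<close>

lemma orbit_covering:
  fixes S :: "'a \<Rightarrow> 'a" and e :: real
  assumes e: "0 \<le> e"
    and block: "\<And>w. w \<in> Z - B \<Longrightarrow>
      \<exists>n. 1 \<le> n \<and> n \<le> K \<and> (\<Sum>t<n. indicat_real V ((S ^^ t) w)) \<le> e * real n"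
  shows "(\<Sum>t<L. indicat_real (V \<inter> Z) ((S ^^ t) w)) \<le>
    e * real L + real K + (\<Sum>t<L. indicat_real B ((S ^^ t) w))"
proof (induction L arbitrary: w rule: less_induct)
  case (less L)
  let ?c = "\<lambda>L w. \<Sum>t<L. indicat_real (V \<inter> Z) ((S ^^ t) w)"
  let ?b = "\<lambda>L w. \<Sum>t<L. indicat_real B ((S ^^ t) w)"
  have split_c: "?c (n + m) w = ?c n w + ?c m ((S ^^ n) w)" for n m
    by (simp add: sum_lessThan_add funpow_apply_add)
  have split_b: "?b (n + m) w = ?b n w + ?b m ((S ^^ n) w)" for n m
    by (simp add: sum_lessThan_add funpow_apply_add)
  have b_nonneg: "0 \<le> ?b n w" for n by (intro sum_nonneg) auto
  have step: ?case if le: "n \<le> L" and "1 \<le> n" and n: "?c n w \<le> e * real n + ?b n w" for n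
  proof -
    obtain m where m: "L = n + m" using le_Suc_ex[OF le] by blast
    have "?c m ((S ^^ n) w) \<le> e * real m + real K + ?b m ((S ^^ n) w)"
      using m that(2) by (intro less.IH) simp
    then show ?thesis
      unfolding m split_c split_b using n by (simp add: algebra_simps)
  qed
  show ?case
  proof (cases "L \<le> K")
    case True
    have "?c L w \<le> (\<Sum>t<L. 1)" by (intro sum_mono) (auto simp: indicator_def)
    also have "\<dots> \<le> real K" using True by simp
    finally show ?thesis using b_nonneg[of L] e by (simp add: add_increasing add_increasing2)
  next
    case False
    then have L: "1 \<le> L" by simp
    show ?thesis
    proof (cases "w \<in> Z - B")
      case True
      then obtain n where n: "1 \<le> n" "n \<le> K" "(\<Sum>t<n. indicat_real V ((S ^^ t) w)) \<le> e * real n"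
        using block by blast
      have "?c n w \<le> (\<Sum>t<n. indicat_real V ((S ^^ t) w))"
        by (intro sum_mono) (auto simp: indicator_def)
      then show ?thesis using n False b_nonneg[of n] by (intro step[of n]) auto
    next
      case False
      then have "?c 1 w \<le> e * real 1 + ?b 1 w"
        using e by (auto simp: indicator_def)
      then show ?thesis using L by (intro step[of 1]) auto
    qed
  qed
qed

text \<open>
  A quantitative form of Poincare's recurrence theorem.  If the visits to \<open>V\<close> have small averages
  at all points of \<open>Z\<close>, the covering lemma bounds the averages of the visits to \<open>V \<inter> Z\<close> along
  every orbit; integrating and using invariance, the measure of \<open>V \<inter> Z\<close> is small.
\<close>

lemma (in finite_measure) recurrence_positive_frequency:
  assumes S: "S \<in> measurable M M" and inv: "distr M M S = M" and V: "V \<in> sets M"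
  shows "AE w in M. w \<in> V \<longrightarrow> 0 < lower_density (return_set S w V)"
proof -
  have Sn: "(S ^^ t) \<in> measurable M M" for t
  proof (induction t)
    case (Suc t)
    then show ?case using S by (simp add: measurable_comp)
  qed (simp add: id_def)
  have inv1: "measure M (S -` A \<inter> space M) = measure M A" if "A \<in> sets M" for A
    using measure_distr[OF S that] inv by simp
  have invn: "measure M ((S ^^ t) -` A \<inter> space M) = measure M A" if A: "A \<in> sets M" for A t
    using A
  proof (induction t arbitrary: A)
    case 0
    then show ?case using sets.Int_space_eq2 by fastforce
  next
    case (Suc t)
    have "(S ^^ Suc t) -` A \<inter> space M = (S ^^ t) -` (S -` A \<inter> space M) \<inter> space M"
      using measurable_space[OF Sn[of t]] by auto
    then show ?case
      using Suc.IH[OF measurable_sets[OF S Suc.prems]] inv1[OF Suc.prems] by (simp only:)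
  qed
  have int_ind: "integrable M (\<lambda>w. indicat_real A ((S ^^ t) w))"
    "(\<integral>w. indicat_real A ((S ^^ t) w) \<partial>M) = measure M A" if A: "A \<in> sets M" for A t
  proof -
    have pre: "(S ^^ t) -` A \<inter> space M \<in> sets M" using Sn A by (rule measurable_sets)
    have eq: "indicat_real A ((S ^^ t) w) = indicat_real ((S ^^ t) -` A \<inter> space M) w"
      if "w \<in> space M" for w
      using that by (simp add: indicator_def)
    have "integrable M (\<lambda>w. indicat_real A ((S ^^ t) w)) \<longleftrightarrow>
        integrable M (indicat_real ((S ^^ t) -` A \<inter> space M))"
      by (rule Bochner_Integration.integrable_cong[OF refl]) (rule eq)
    moreover have "integrable M (indicat_real ((S ^^ t) -` A \<inter> space M))"
      using pre by (rule integrable_real_indicator) (simp add: emeasure_eq_measure)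
    ultimately show "integrable M (\<lambda>w. indicat_real A ((S ^^ t) w))" by simp
    have "(\<integral>w. indicat_real A ((S ^^ t) w) \<partial>M) =
        (\<integral>w. indicat_real ((S ^^ t) -` A \<inter> space M) w \<partial>M)"
      by (rule Bochner_Integration.integral_cong[OF refl]) (rule eq)
    also have "(\<integral>w. indicat_real ((S ^^ t) -` A \<inter> space M) w \<partial>M) = measure M A"
      using invn[OF A, of t] by simp
    finally show "(\<integral>w. indicat_real A ((S ^^ t) w) \<partial>M) = measure M A" .
  qed
  define f where "f n w = (\<Sum>t<n. indicat_real V ((S ^^ t) w))" for n w
  have f_meas [measurable]: "f n \<in> borel_measurable M" for n
    unfolding f_def using borel_measurable_integrable[OF int_ind(1)[OF V]] by measurable
  \<comment> \<open>Where the averages come arbitrarily close to 0.  Off \<open>Z\<close> they are bounded below, uniformly in \<open>n\<close>,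
    which is stronger than a positive lower density.\<close>
  define Z where "Z = {w \<in> space M. \<forall>m::nat. \<exists>n\<ge>1. f n w \<le> (1 / real (Suc m)) * real n}"
  have Z [measurable]: "Z \<in> sets M"
    unfolding Z_def by measurable
  have card_f: "real (card (return_set S w V \<inter> {0..N})) = f (Suc N) w" for N w
  proof -
    have "return_set S w V \<inter> {0..N} = {t \<in> {..<Suc N}. (S ^^ t) w \<in> V}"
      by (auto simp: return_set_def)
    then have "real (card (return_set S w V \<inter> {0..N})) = (\<Sum>t\<in>{t \<in> {..<Suc N}. (S ^^ t) w \<in> V}. 1)"
      by simp
    also have "\<dots> = (\<Sum>t<Suc N. if (S ^^ t) w \<in> V then 1 else 0)"
      by (rule sum.inter_filter) simp
    also have "\<dots> = f (Suc N) w"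
      unfolding f_def by (rule sum.cong) (auto simp: indicator_def)
    finally show ?thesis .
  qed
  have small: "measure M (V \<inter> Z) \<le> e * (measure M (space M) + 1)" if "0 < e" for e
  proof -
    obtain m where m: "1 / real (Suc m) < e" using reals_Archimedean[OF \<open>0 < e\<close>]
      by (auto simp: inverse_eq_divide)
    \<comment> \<open>The points where an average drops below \<open>e\<close> within time \<open>K\<close> exhaust \<open>Z\<close> as \<open>K\<close> grows; the exceptional
      set \<open>B\<close> of the covering lemma is what is left of \<open>Z\<close>.\<close>
    define G where "G K = {w \<in> space M. \<exists>n\<in>{1..K}. f n w \<le> e * real n}" for K :: nat
    have G [measurable]: "G K \<in> sets M" for K unfolding G_def by measurable
    have ZG: "Z \<subseteq> (\<Union>K. G K)"
    proof
      fix w assume "w \<in> Z"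
      then obtain n where n: "n \<ge> 1" "f n w \<le> (1 / real (Suc m)) * real n" and w: "w \<in> space M"
        unfolding Z_def by blast
      have "f n w \<le> e * real n"
        using n(2) m mult_right_mono[of "1 / real (Suc m)" e "real n"] by simp
      then have "w \<in> G n" using n(1) w by (auto simp: G_def)
      then show "w \<in> (\<Union>K. G K)" by blast
    qed
    have "(\<lambda>K. measure M (Z - G K)) \<longlonglongrightarrow> measure M (\<Inter>K. Z - G K)"
      by (intro finite_Lim_measure_decseq) (auto simp: decseq_def G_def)
    moreover have "(\<Inter>K. Z - G K) = {}" using ZG by blast
    ultimately have "(\<lambda>K. measure M (Z - G K)) \<longlonglongrightarrow> 0" by (simp only: measure_empty)
    then have "eventually (\<lambda>K. measure M (Z - G K) < e) sequentially"
      using \<open>0 < e\<close> by (rule order_tendstoD)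
    then obtain K where K: "measure M (Z - G K) < e"
      by (auto simp: eventually_sequentially)
    have bound: "real L * measure M (V \<inter> Z) \<le>
        (e * real L + real K) * measure M (space M) + real L * measure M (Z - G K)" for L
    proof -
      have "real L * measure M (V \<inter> Z) = (\<integral>w. (\<Sum>t<L. indicat_real (V \<inter> Z) ((S ^^ t) w)) \<partial>M)"
        using V by (simp add: int_ind)
      also have "\<dots> \<le> (\<integral>w. e * real L + real K + (\<Sum>t<L. indicat_real (Z - G K) ((S ^^ t) w)) \<partial>M)"
      proof (rule integral_mono)
        show "integrable M (\<lambda>w. \<Sum>t<L. indicat_real (V \<inter> Z) ((S ^^ t) w))"
          using V by (intro Bochner_Integration.integrable_sum int_ind) auto
        show "integrable M (\<lambda>w. e * real L + real K + (\<Sum>t<L. indicat_real (Z - G K) ((S ^^ t) w)))"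
          by (intro Bochner_Integration.integrable_add Bochner_Integration.integrable_sum int_ind) auto
        show "(\<Sum>t<L. indicat_real (V \<inter> Z) ((S ^^ t) w))
            \<le> e * real L + real K + (\<Sum>t<L. indicat_real (Z - G K) ((S ^^ t) w))" for w
        proof (rule orbit_covering)
          show "0 \<le> e" using \<open>0 < e\<close> by simp
          fix w assume "w \<in> Z - (Z - G K)"
          then show "\<exists>n. 1 \<le> n \<and> n \<le> K \<and> (\<Sum>t<n. indicat_real V ((S ^^ t) w)) \<le> e * real n"
            by (auto simp: G_def f_def)
        qed
      qed
      also have "\<dots> = (e * real L + real K) * measure M (space M) + real L * measure M (Z - G K)"
      proof -
        have "integrable M (\<lambda>w. \<Sum>t<L. indicat_real (Z - G K) ((S ^^ t) w))"
          by (intro Bochner_Integration.integrable_sum int_ind) auto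
        then show ?thesis
          by (subst Bochner_Integration.integral_add) (auto simp: int_ind)
      qed
      finally show ?thesis .
    qed
    have le: "measure M (V \<inter> Z) \<le> e * measure M (space M) + e + (real K * measure M (space M)) / real L"
      if "L \<ge> 1" for L
    proof -
      have "real L * measure M (Z - G K) \<le> real L * e"
        using K by (intro mult_left_mono) auto
      then have "real L * measure M (V \<inter> Z) \<le> (e * real L + real K) * measure M (space M) + real L * e"
        using bound[of L] by linarith
      then show ?thesis using that by (simp add: field_simps)
    qed
    have "(\<lambda>L. e * measure M (space M) + e + (real K * measure M (space M)) / real L)
        \<longlonglongrightarrow> e * measure M (space M) + e + 0"
      by (intro tendsto_add tendsto_const lim_const_over_n)
    then have "measure M (V \<inter> Z) \<le> e * measure M (space M) + e + 0"
      using le by (intro LIMSEQ_le_const) blast+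
    then show ?thesis by (simp add: algebra_simps)
  qed
  have "measure M (V \<inter> Z) \<le> 0"
  proof (rule ccontr)
    assume "\<not> ?thesis"
    then have p: "0 < measure M (V \<inter> Z)" by simp
    define q where "q = measure M (space M) + 1"
    have q: "q > 0" unfolding q_def using measure_nonneg[of M "space M"] by linarith
    have "measure M (V \<inter> Z) \<le> measure M (V \<inter> Z) / (2 * q) * q"
      unfolding q_def[symmetric] using p q small[of "measure M (V \<inter> Z) / (2 * q)"]
      by (simp add: q_def[symmetric])
    then show False using p q by simp
  qed
  then have "emeasure M (V \<inter> Z) = 0"
    using measure_nonneg[of M "V \<inter> Z"] by (simp add: emeasure_eq_measure)
  then have "V \<inter> Z \<in> null_sets M" using V by (intro null_setsI) auto
  then have "AE w in M. w \<notin> V \<inter> Z" by (rule AE_not_in)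
  then show ?thesis
    using AE_space
  proof eventually_elim
    case (elim w)
    show ?case
    proof
      assume "w \<in> V"
      with elim obtain m where m: "\<And>n. n \<ge> 1 \<Longrightarrow> \<not> f n w \<le> (1 / real (Suc m)) * real n"
        unfolding Z_def by blast
      show "0 < lower_density (return_set S w V)"
      proof (rule lower_density_posI[of "1 / real (Suc m)"])
        show "1 / real (Suc m) * real (N + 1) \<le> real (card (return_set S w V \<inter> {0..N}))" for N
          unfolding card_f using m[of "Suc N"] by simp
      qed simp
    qed
  qed
qed

section \<open>Systems with weakly convergent bounded orbits\<close>

text \<open>
  The common features of adjoint operators on dual spaces and of operators on reflexive spaces: \<open>E\<close> is
  a space of test vectors, \<open>pair\<close> evaluates elements of \<open>X\<close> on them, and weak limits refer
  to convergence on all of \<open>E\<close>.  The assumption \<open>weak_limits\<close> expresses the weak compactness of balls,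
  \<open>norming\<close> their weak closedness and \<open>adjoint\<close> the weak continuity of \<open>T\<close>.
\<close>

locale adjoint_system =
  fixes X :: "'v::banach set" and T :: "'v \<Rightarrow> 'v"
    and pair :: "'v \<Rightarrow> 'd::real_normed_vector \<Rightarrow> 'k::euclidean_space" and E :: "'d set"
  assumes subspace_X: "subspace X" and closed_X: "closed X"
    and separable_X: "separable_space (top_of_set X)"
    and T_mem: "x \<in> X \<Longrightarrow> T x \<in> X"
    and T_add: "x \<in> X \<Longrightarrow> y \<in> X \<Longrightarrow> T (x + y) = T x + T y"
    and T_bounded: "\<exists>C. \<forall>x\<in>X. norm (T x) \<le> C * norm x"
    and pair_diff: "x \<in> X \<Longrightarrow> y \<in> X \<Longrightarrow> d \<in> E \<Longrightarrow> pair (x - y) d = pair x d - pair y d"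
    and pair_bound: "x \<in> X \<Longrightarrow> d \<in> E \<Longrightarrow> norm (pair x d) \<le> norm x * norm d"
    and norming: "x \<in> X \<Longrightarrow> 0 \<le> r \<Longrightarrow> r < norm x \<Longrightarrow> \<exists>d\<in>E. norm d \<le> 1 \<and> r < norm (pair x d)"
    and weak_limits: "ultrafilter (F :: nat filter) \<Longrightarrow> (\<And>i. f i \<in> X) \<Longrightarrow> (\<And>i. norm (f i) \<le> C) \<Longrightarrow>
      \<exists>g\<in>X. \<forall>d\<in>E. ((\<lambda>i. pair (f i) d) \<longlongrightarrow> pair g d) F"
    and adjoint: "d \<in> E \<Longrightarrow> \<exists>d'\<in>E. \<forall>x\<in>X. pair (T x) d = pair x d'"
begin

lemma funpow_mem: "x \<in> X \<Longrightarrow> (T ^^ k) x \<in> X"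
  by (induction k) (auto simp: T_mem)

lemma diff_mem: "x \<in> X \<Longrightarrow> y \<in> X \<Longrightarrow> x - y \<in> X"
  using subspace_X by (rule subspace_diff)

lemma pair_determines:
  assumes "x \<in> X" "y \<in> X" "\<And>d. d \<in> E \<Longrightarrow> pair x d = pair y d"
  shows "x = y"
proof (rule ccontr)
  assume "x \<noteq> y"
  then obtain d where "d \<in> E" "0 < norm (pair (x - y) d)"
    using norming[of "x - y" 0] diff_mem assms by auto
  then show False using assms pair_diff by simp
qed

definition dense_set :: "'v set"
  where "dense_set = (SOME C. countable C \<and> C \<subseteq> X \<and> top_of_set X closure_of C = X)"

lemma dense_set: "countable dense_set" "dense_set \<subseteq> X" "top_of_set X closure_of dense_set = X"
proof -
  have "\<exists>C. countable C \<and> C \<subseteq> X \<and> top_of_set X closure_of C = X"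
    using separable_X by (simp add: separable_space_def)
  from someI_ex[OF this] show "countable dense_set" "dense_set \<subseteq> X"
    "top_of_set X closure_of dense_set = X"
    unfolding dense_set_def by blast+
qed

lemma dense_set_approx:
  assumes "x \<in> X" "0 < e"
  obtains c where "c \<in> dense_set" "norm (x - c) < e"
proof -
  have "x \<in> top_of_set X closure_of dense_set" using assms dense_set by simp
  moreover have "openin (top_of_set X) (X \<inter> ball x e)" by (simp add: openin_open_Int)
  ultimately obtain c where "c \<in> dense_set" "c \<in> X \<inter> ball x e"
    unfolding in_closure_of using assms by (meson Int_iff centre_in_ball)
  then show thesis using that by (auto simp: dist_norm)
qed

text \<open>
  Choose for each point \<open>c\<close> of a countable dense set, and each rational below its norm, a test
  vector on which \<open>c\<close> exceeds that rational; every vector is approximated by such \<open>c\<close>.  Countability of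
  \<open>D\<close> is needed for the measurability of balls, and so this is one of the places where separability enters.
\<close>

lemma countable_norming:
  obtains D where "countable D" "D \<subseteq> E" "\<And>d. d \<in> D \<Longrightarrow> norm d \<le> 1"
    "\<And>x r. x \<in> X \<Longrightarrow> 0 \<le> r \<Longrightarrow> (\<And>d. d \<in> D \<Longrightarrow> norm (pair x d) \<le> r) \<Longrightarrow> norm x \<le> r"
proof -
  have "\<exists>d. \<not> (0 \<le> q \<and> q < norm c) \<or> (d \<in> E \<and> norm d \<le> 1 \<and> q < norm (pair c d))" if "c \<in> X" for c q
    using norming[OF that] by blast
  then obtain w where w: "\<And>c q. c \<in> X \<Longrightarrow> 0 \<le> q \<Longrightarrow> q < norm c \<Longrightarrow>
      w c q \<in> E \<and> norm (w c q) \<le> 1 \<and> q < norm (pair c (w c q))"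
    by metis
  define I where "I = {(c, q). c \<in> dense_set \<and> q \<in> \<rat> \<and> 0 \<le> q \<and> q < norm c}"
  define D where "D = (\<lambda>(c, q). w c q) ` I"
  have "I \<subseteq> dense_set \<times> \<rat>" by (auto simp: I_def)
  then have "countable I"
    using countable_subset dense_set(1) countable_rat countable_SIGMA by metis
  then have "countable D" by (simp add: D_def)
  moreover have DE: "D \<subseteq> E" and D1: "\<And>d. d \<in> D \<Longrightarrow> norm d \<le> 1"
    using w dense_set(2) by (auto simp: D_def I_def)
  moreover have "norm x \<le> r" if x: "x \<in> X" and r: "0 \<le> r" and le: "\<And>d. d \<in> D \<Longrightarrow> norm (pair x d) \<le> r" for x r
  proof (rule ccontr)
    assume "\<not> norm x \<le> r"
    define e where "e = (norm x - r) / 4"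
    have e: "0 < e" "norm x = r + 4 * e" using \<open>\<not> norm x \<le> r\<close> by (auto simp: e_def field_simps)
    obtain c where c: "c \<in> dense_set" "norm (x - c) < e" using dense_set_approx[OF x e(1)] .
    have "norm c > r + 2 * e" using c(2) e norm_triangle_ineq[of "x - c" c] by simp
    then obtain q where q: "q \<in> \<rat>" "r + e < q" "q < norm c"
      using Rats_dense_in_real[of "r + e" "norm c"] e by auto
    have cq: "(c, q) \<in> I" using c q r e by (auto simp: I_def)
    define d where "d = w c q"
    have dD: "d \<in> D" using cq by (force simp: D_def d_def)
    have cX: "c \<in> X" using c dense_set by blast
    have "q < norm (pair c d)" unfolding d_def using w[OF cX, of q] q r e by auto
    also have "pair c d = pair x d - pair (x - c) d"
      using x cX dD DE by (subst pair_diff) auto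
    also have "norm \<dots> \<le> norm (pair x d) + norm (pair (x - c) d)" by (rule norm_triangle_ineq4)
    also have "\<dots> \<le> r + norm (x - c) * norm d"
      using le[OF dD] pair_bound[of "x - c" d] x cX dD DE diff_mem by (intro add_mono) auto
    also have "\<dots> \<le> r + norm (x - c) * 1"
      using D1[OF dD] by (intro add_left_mono mult_left_mono) auto
    finally show False using c(2) q(2) by simp
  qed
  ultimately show thesis using that by blast
qed

definition weak_lim :: "nat filter \<Rightarrow> (nat \<Rightarrow> 'v) \<Rightarrow> 'v"
  where "weak_lim F f = (SOME g. g \<in> X \<and> (\<forall>d\<in>E. ((\<lambda>i. pair (f i) d) \<longlongrightarrow> pair g d) F))"

lemma weak_lim:
  assumes F: "ultrafilter F" and f: "\<And>i. f i \<in> X" and bd: "eventually (\<lambda>i. norm (f i) \<le> C) F"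
  shows "weak_lim F f \<in> X" and "d \<in> E \<Longrightarrow> ((\<lambda>i. pair (f i) d) \<longlongrightarrow> pair (weak_lim F f) d) F"
proof -
  define f' where "f' i = (if norm (f i) \<le> C then f i else 0)" for i
  have "\<exists>g\<in>X. \<forall>d\<in>E. ((\<lambda>i. pair (f' i) d) \<longlongrightarrow> pair g d) F"
    by (rule weak_limits[OF F, of _ "max C 0"])
      (auto simp: f'_def f subspace_0[OF subspace_X])
  then obtain g where g: "g \<in> X" "\<And>d. d \<in> E \<Longrightarrow> ((\<lambda>i. pair (f' i) d) \<longlongrightarrow> pair g d) F" by blast
  have "((\<lambda>i. pair (f i) d) \<longlongrightarrow> pair g d) F" if "d \<in> E" for d
  proof (rule Lim_transform_eventually[OF g(2)[OF that]])
    show "eventually (\<lambda>i. pair (f' i) d = pair (f i) d) F"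
      using bd by eventually_elim (simp add: f'_def)
  qed
  then have "\<exists>g. g \<in> X \<and> (\<forall>d\<in>E. ((\<lambda>i. pair (f i) d) \<longlongrightarrow> pair g d) F)" using g(1) by blast
  from someI_ex[OF this] show "weak_lim F f \<in> X"
    and "d \<in> E \<Longrightarrow> ((\<lambda>i. pair (f i) d) \<longlongrightarrow> pair (weak_lim F f) d) F"
    unfolding weak_lim_def by blast+
qed

lemma weak_lim_T:
  assumes F: "ultrafilter F" and f: "\<And>i. f i \<in> X" and bd: "eventually (\<lambda>i. norm (f i) \<le> C) F"
    and bd': "eventually (\<lambda>i. norm (T (f i)) \<le> C') F"
  shows "weak_lim F (\<lambda>i. T (f i)) = T (weak_lim F f)"
proof (rule pair_determines)
  have Tf: "T (f i) \<in> X" for i using f T_mem by blast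
  show "weak_lim F (\<lambda>i. T (f i)) \<in> X" by (rule weak_lim(1)[OF F Tf bd'])
  show "T (weak_lim F f) \<in> X" using weak_lim(1)[OF F f bd] T_mem by blast
  fix d assume d: "d \<in> E"
  obtain d' where d': "d' \<in> E" "\<And>x. x \<in> X \<Longrightarrow> pair (T x) d = pair x d'" using adjoint[OF d] by blast
  have "((\<lambda>i. pair (T (f i)) d) \<longlongrightarrow> pair (T (weak_lim F f)) d) F"
    using weak_lim(2)[OF F f bd d'(1)] d'(2) f weak_lim(1)[OF F f bd] by simp
  then show "pair (weak_lim F (\<lambda>i. T (f i))) d = pair (T (weak_lim F f)) d"
    using weak_lim(2)[OF F Tf bd' d] tendsto_unique ultrafilter_not_bot[OF F] by blast
qed

lemma weak_lim_in_cball: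
  assumes F: "ultrafilter F" and f: "\<And>i. f i \<in> X" and c: "c \<in> X" and r: "0 \<le> r"
    and ev: "eventually (\<lambda>i. norm (f i - c) \<le> r) F"
  shows "norm (weak_lim F f - c) \<le> r"
proof (rule ccontr)
  assume n: "\<not> ?thesis"
  have bd: "eventually (\<lambda>i. norm (f i) \<le> r + norm c) F"
    using ev
  proof eventually_elim
    case (elim i)
    then show ?case using norm_triangle_ineq[of "f i - c" c] by simp
  qed
  note lim = weak_lim[OF F f bd]
  obtain d where d: "d \<in> E" "norm d \<le> 1" "r < norm (pair (weak_lim F f - c) d)"
    using norming[OF diff_mem[OF lim(1) c] r] n by auto
  have "((\<lambda>i. norm (pair (f i) d - pair c d)) \<longlongrightarrow> norm (pair (weak_lim F f) d - pair c d)) F"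
    by (intro tendsto_intros lim(2) d)
  moreover have "eventually (\<lambda>i. norm (pair (f i) d - pair c d) \<le> r) F"
    using ev
  proof eventually_elim
    case (elim i)
    have "norm (pair (f i - c) d) \<le> norm (f i - c) * norm d"
      using pair_bound diff_mem f c d by blast
    also have "\<dots> \<le> r * 1" using elim d(2) r by (intro mult_mono) auto
    finally show ?case using pair_diff f c d by simp
  qed
  ultimately have "norm (pair (weak_lim F f) d - pair c d) \<le> r"
    using tendsto_upperbound ultrafilter_not_bot[OF F] by blast
  then show False using d(3) pair_diff lim(1) c d(1) by simp
qed

text \<open>
  Tested on a countable set, the membership of the limit in a closed ball becomes a countable
  intersection of conditions on almost all members of the sequence, hence of internal sets.
\<close>

lemma weak_lim_in_cball_iff:
  assumes F: "ultrafilter F" and f: "\<And>i. f i \<in> X" and bd: "eventually (\<lambda>i. norm (f i) \<le> C) F"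
    and c: "c \<in> X" and r: "0 \<le> r"
    and D: "D \<subseteq> E"
      "\<And>x r. x \<in> X \<Longrightarrow> 0 \<le> r \<Longrightarrow> (\<And>d. d \<in> D \<Longrightarrow> norm (pair x d) \<le> r) \<Longrightarrow> norm x \<le> r"
      "\<And>d. d \<in> D \<Longrightarrow> norm d \<le> 1"
  shows "norm (weak_lim F f - c) \<le> r \<longleftrightarrow>
    (\<forall>d\<in>D. \<forall>p::nat. eventually (\<lambda>i. norm (pair (f i - c) d) \<le> r + 1 / real (Suc p)) F)"
proof -
  note lim = weak_lim[OF F f bd]
  have tend: "((\<lambda>i. norm (pair (f i - c) d)) \<longlongrightarrow> norm (pair (weak_lim F f - c) d)) F" if "d \<in> D" for d
  proof -
    have d: "d \<in> E" using that D by blast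
    have "((\<lambda>i. norm (pair (f i) d - pair c d)) \<longlongrightarrow> norm (pair (weak_lim F f) d - pair c d)) F"
      by (intro tendsto_intros lim(2) d)
    then show ?thesis using pair_diff f c d lim(1) by simp
  qed
  show ?thesis
  proof
    assume le: "norm (weak_lim F f - c) \<le> r"
    show "\<forall>d\<in>D. \<forall>p::nat. eventually (\<lambda>i. norm (pair (f i - c) d) \<le> r + 1 / real (Suc p)) F"
    proof (intro ballI allI)
      fix d p assume d: "d \<in> D"
      have "norm (pair (weak_lim F f - c) d) \<le> norm (weak_lim F f - c) * norm d"
        using pair_bound diff_mem lim(1) c d D(1) by blast
      also have "\<dots> \<le> r * 1" using le D(3)[OF d] r by (intro mult_mono) auto
      also have "\<dots> < r + 1 / real (Suc p)" by simp
      finally have "eventually (\<lambda>i. norm (pair (f i - c) d) < r + 1 / real (Suc p)) F"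
        by (rule order_tendstoD(2)[OF tend[OF d]])
      then show "eventually (\<lambda>i. norm (pair (f i - c) d) \<le> r + 1 / real (Suc p)) F"
        by (rule eventually_mono) simp
    qed
  next
    assume ev: "\<forall>d\<in>D. \<forall>p::nat. eventually (\<lambda>i. norm (pair (f i - c) d) \<le> r + 1 / real (Suc p)) F"
    show "norm (weak_lim F f - c) \<le> r"
    proof (rule D(2)[OF diff_mem[OF lim(1) c] r])
      fix d assume d: "d \<in> D"
      have le: "norm (pair (weak_lim F f - c) d) \<le> r + 1 / real (Suc p)" for p
        using tendsto_upperbound[OF tend[OF d]] ev d ultrafilter_not_bot[OF F] by blast
      show "norm (pair (weak_lim F f - c) d) \<le> r"
      proof (rule field_le_epsilon)
        fix e :: real assume "0 < e"
        then obtain p where "1 / real (Suc p) < e"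
          using reals_Archimedean by (auto simp: inverse_eq_divide)
        then show "norm (pair (weak_lim F f - c) d) \<le> r + e" using le[of p] by linarith
      qed
    qed
  qed
qed

end

section \<open>Boxes and direct sums\<close>

lemma direct_sum_power_funpow:
  assumes "v \<in> extensional {..<n}"
  shows "(direct_sum_power n T ^^ t) v = (\<lambda>i\<in>{..<n}. (T ^^ t) (v i))"
proof (induction t)
  case 0
  then show ?case using assms by (auto simp: extensional_def restrict_def)
qed (auto simp: direct_sum_power_def restrict_def)

text \<open>
  Coordinates beyond \<open>n\<close> are left alone: this keeps the map injective on all functions, and the value
  \<open>undefined\<close> outside \<open>{..<n}\<close> in place.
\<close>

definition box_shift :: "nat \<Rightarrow> (nat \<Rightarrow> nat) \<Rightarrow> nat \<Rightarrow> nat"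
  where "box_shift n a = (\<lambda>j. if j < n then Suc (a j) else a j)"

lemma inj_box_shift: "inj (box_shift n)"
proof (rule injI, rule ext)
  fix a b j assume "box_shift n a = box_shift n b"
  from fun_cong[OF this, of j] show "a j = b j"
    by (auto simp: box_shift_def split: if_splits)
qed

text \<open>
  A point of the box that is not the shift of a point of the box is at the left end in some coordinate \<open>j\<close>, and
  these points make up the fraction \<open>1 / (N j + 1)\<close> of the box.
\<close>

lemma box_boundary:
  fixes n :: nat and m N :: "nat \<Rightarrow> nat"
  defines "W \<equiv> PiE {..<n} (\<lambda>j. {m j..m j + N j})"
  assumes K: "\<And>j. j < n \<Longrightarrow> K \<le> N j"
  shows "real (card (W - box_shift n ` W)) / real (card W) \<le> real n / real (Suc K)"
proof -
  define B where "B j = PiE {..<n} (\<lambda>l. if l = j then {m j} else {m l..m l + N l})" for j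
  have cW: "card W = (\<Prod>l<n. Suc (N l))" by (simp add: W_def card_PiE)
  have cW_pos: "0 < card W" unfolding cW by (simp add: prod_pos)
  have cB: "card (B j) * Suc (N j) = card W" if "j < n" for j
  proof -
    have "card (B j) = (\<Prod>l<n. if l = j then 1 else Suc (N l))"
      unfolding B_def by (subst card_PiE) (auto intro!: prod.cong)
    also have "\<dots> = (\<Prod>l\<in>{..<n} - {j}. Suc (N l))"
      using that by (subst prod.remove[of _ j]) (auto intro!: prod.cong)
    finally show ?thesis
      using that prod.remove[of "{..<n}" j "\<lambda>l. Suc (N l)"] by (simp only: cW) simp
  qed
  have sub: "W - box_shift n ` W \<subseteq> (\<Union>j<n. B j)"
  proof
    fix a assume a: "a \<in> W - box_shift n ` W"
    show "a \<in> (\<Union>j<n. B j)"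
    proof (rule ccontr)
      assume n: "a \<notin> (\<Union>j<n. B j)"
      have ne: "a j \<noteq> m j" if "j < n" for j
        using n a that by (auto simp: B_def W_def PiE_iff split: if_splits)
      have aW: "m j \<le> a j" "a j \<le> m j + N j" if "j < n" for j
        using a that by (auto simp: W_def PiE_iff)
      define b where "b = (\<lambda>j. if j < n then a j - 1 else a j)"
      have pos: "m j \<le> a j - 1" "a j > 0" if "j < n" for j
        using ne[OF that] aW[OF that] by auto
      have "b \<in> W"
        using a pos aW by (fastforce simp: b_def W_def PiE_iff extensional_def)
      moreover have "box_shift n b = a"
        using pos by (auto simp: box_shift_def b_def)
      ultimately show False using a by blast
    qed
  qed
  have finB: "finite (B j)" for j unfolding B_def by (intro finite_PiE) auto
  have "card (W - box_shift n ` W) \<le> card (\<Union>j<n. B j)"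
    using sub finB by (intro card_mono) auto
  also have "\<dots> \<le> (\<Sum>j<n. card (B j))" by (rule card_UN_le) simp
  finally have "real (card (W - box_shift n ` W)) \<le> (\<Sum>j<n. real (card (B j)))"
    by (simp only: of_nat_sum[symmetric] of_nat_le_iff)
  also have "\<dots> \<le> (\<Sum>j<n. real (card W) / real (Suc K))"
  proof (rule sum_mono)
    fix j assume j: "j \<in> {..<n}"
    have "card (B j) * Suc K \<le> card (B j) * Suc (N j)" using K[of j] j by (intro mult_left_mono) auto
    then have "card (B j) * Suc K \<le> card W" using cB[of j] j by (simp only: lessThan_iff)
    then have "real (card (B j)) * real (Suc K) \<le> real (card W)"
      by (simp only: of_nat_mult[symmetric] of_nat_le_iff)
    then show "real (card (B j)) \<le> real (card W) / real (Suc K)"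
      by (simp add: pos_le_divide_eq del: of_nat_Suc)
  qed
  also have "\<dots> = real n / real (Suc K) * real (card W)" by simp
  finally show ?thesis using cW_pos by (simp add: pos_divide_le_eq del: of_nat_Suc)
qed

section \<open>Frequent recurrence of the direct sums\<close>

lemma power_topology_box:
  assumes "openin (power_topology n \<tau>) U" "f \<in> U"
  obtains V where "\<And>j. j < n \<Longrightarrow> openin \<tau> (V j)" "f \<in> PiE {..<n} V" "PiE {..<n} V \<subseteq> U"
  using assms unfolding openin_product_topology_alt by (metis lessThan_iff)

lemma open_in_subspace_cball:
  fixes X :: "'v::metric_space set"
  assumes "openin (top_of_set X) V" "u \<in> V"
  obtains r where "0 < r" "X \<inter> cball u r \<subseteq> V"
proof -
  obtain S where S: "open S" "V = X \<inter> S" using assms(1) by (auto simp: openin_open)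
  then obtain r where "0 < r" "cball u r \<subseteq> S" using assms(2) open_contains_cball by blast
  then show thesis using that S by blast
qed

context adjoint_system
begin

lemma dense_cball:
  assumes V: "openin (top_of_set X) V" and y: "y \<in> V"
  obtains c p where "c \<in> dense_set" "norm (y - c) \<le> 1 / real (Suc p)"
    "X \<inter> cball c (1 / real (Suc p)) \<subseteq> V"
proof -
  have yX: "y \<in> X" using openin_subset[OF V] y by auto
  obtain e where e: "0 < e" "X \<inter> cball y e \<subseteq> V" using open_in_subspace_cball[OF V y] by blast
  obtain p where p: "1 / real (Suc p) < e / 2"
    using reals_Archimedean[of "e / 2"] e(1) by (auto simp: inverse_eq_divide)
  obtain c where c: "c \<in> dense_set" "norm (y - c) < 1 / real (Suc p)"
    using dense_set_approx[OF yX, of "1 / real (Suc p)"] by auto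
  have "cball c (1 / real (Suc p)) \<subseteq> cball y e"
  proof
    fix z assume "z \<in> cball c (1 / real (Suc p))"
    then show "z \<in> cball y e"
      using dist_triangle[of y z c] c(2) p by (simp add: dist_norm)
  qed
  then show thesis using that[of c p] c e(2) by auto
qed

text \<open>
  A point \<open>k\<close> of the measure space is a sequence of \<open>n\<close>-tuples of times, and \<open>y k\<close> is the \<open>n\<close>-tuple of the weak
  limits of the orbit of \<open>x\<close> at these times.  Advancing all times by one applies \<open>T\<close> to every \<open>y k j\<close>, so the
  recurrence of \<open>k\<close> under the shift is the recurrence of \<open>y k\<close> under the direct sum.
\<close>

lemma frequently_recurrent_point:
  assumes rh: "reiteratively_hypercyclic (top_of_set X) T"
    and U: "openin (power_topology n (top_of_set X)) U" "U \<noteq> {}"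
  obtains f where "f \<in> U"
    "\<And>N. neighbourhood_in (power_topology n (top_of_set X)) f N \<Longrightarrow>
      0 < lower_density (return_set (direct_sum_power n T) f N)"
proof -
  let ?P = "power_topology n (top_of_set X)"
  obtain x where x: "x \<in> X"
    and hyp: "\<And>U. openin (top_of_set X) U \<Longrightarrow> U \<noteq> {} \<Longrightarrow> 0 < upper_Banach_density (return_set T x U)"
    using rh by (auto simp: reiteratively_hypercyclic_def)
  obtain u where u: "u \<in> U" using U(2) by blast
  obtain V where V: "\<And>j. j < n \<Longrightarrow> openin (top_of_set X) (V j)" "u \<in> PiE {..<n} V" "PiE {..<n} V \<subseteq> U"
    by (rule power_topology_box[OF U(1) u]) blast
  have uV: "u j \<in> V j" "u j \<in> X" if "j < n" for j
    using V(2) openin_subset[OF V(1)[OF that]] that by (auto simp: PiE_iff)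
  have "\<exists>r>0. X \<inter> cball (u j) r \<subseteq> V j" if "j < n" for j
    using open_in_subspace_cball[OF V(1)[OF that] uV(1)[OF that]] by blast
  then obtain r where r: "\<And>j. j < n \<Longrightarrow> 0 < r j" "\<And>j. j < n \<Longrightarrow> X \<inter> cball (u j) (r j) \<subseteq> V j"
    by metis
  define A where "A j = return_set T x (X \<inter> ball (u j) (r j))" for j
  have "0 < upper_Banach_density (A j)" if "j < n" for j
    unfolding A_def using uV(2)[OF that] r(1)[OF that]
    by (intro hyp) (auto simp: openin_open_Int)
  then have "\<exists>\<delta>>0. \<forall>L. \<exists>N\<ge>L. \<exists>m. \<delta> * real (N + 1) \<le> real (card (A j \<inter> {m..m+N}))" if "j < n" for j
    using that unfolding upper_Banach_density_pos_iff by blast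
  then obtain \<delta> where \<delta>: "\<And>j. j < n \<Longrightarrow> 0 < \<delta> j"
    and ex_window: "\<And>j L. j < n \<Longrightarrow> \<exists>N\<ge>L. \<exists>m. \<delta> j * real (N + 1) \<le> real (card (A j \<inter> {m..m+N}))"
    by metis
  \<comment> \<open>Windows of length tending to infinity in each coordinate, each with at least the fraction \<open>\<delta> j\<close> of times in \<open>A j\<close>.
    The lengths in different coordinates are unrelated.\<close>
  have "\<forall>i j. \<exists>N m. j < n \<longrightarrow> i \<le> N \<and> \<delta> j * real (N + 1) \<le> real (card (A j \<inter> {m..m+N}))"
    using ex_window by blast
  then obtain N m where Nm: "\<And>i j. j < n \<Longrightarrow> i \<le> N i j"
    "\<And>i j. j < n \<Longrightarrow> \<delta> j * real (N i j + 1) \<le> real (card (A j \<inter> {m i j..m i j + N i j}))"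
    unfolding choice_iff by blast
  define W where "W i = PiE {..<n} (\<lambda>j. {m i j..m i j + N i j})" for i
  obtain F :: "nat filter" where F: "ultrafilter F" "F \<le> sequentially"
    using ultrafilter_below[OF sequentially_bot] .
  interpret loeb_windows F W
  proof
    show "finite (W i)" "W i \<noteq> {}" for i
      by (auto simp: W_def PiE_eq_empty_iff intro: finite_PiE)
  qed (use F in auto)
  define S where "S k i = box_shift n (k i)" for k :: "nat \<Rightarrow> nat \<Rightarrow> nat" and i :: nat
  have "(\<lambda>i. real (card (W i - box_shift n ` W i)) / real (card (W i))) \<longlonglongrightarrow> 0"
  proof (rule tendsto_sandwich[OF always_eventually always_eventually tendsto_const])
    show "(\<lambda>i. real n / real (Suc i)) \<longlonglongrightarrow> 0"
      using LIMSEQ_Suc[OF lim_const_over_n[of "real n"]] .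
    show "\<forall>i. real (card (W i - box_shift n ` W i)) / real (card (W i)) \<le> real n / real (Suc i)"
      unfolding W_def using Nm(1) by (intro allI box_boundary) auto
  qed simp
  note shift = loeb_shift_invariant[OF inj_box_shift this, folded S_def]

  \<comment> \<open>\<open>H\<close> consists of the sequences of times at which the orbit of \<open>x\<close> is bounded, so that its weak limits exist.\<close>
  define orb where "orb k j i = (T ^^ (k i j)) x" for k :: "nat \<Rightarrow> nat \<Rightarrow> nat" and i j
  have orb_X: "orb k j i \<in> X" for k j i unfolding orb_def using x by (rule funpow_mem)
  define y where "y k j = weak_lim F (orb k j)" for k j
  define H where "H = {k. \<forall>j\<in>{..<n}. \<exists>C::nat. eventually (\<lambda>i. norm (orb k j i) \<le> real C) F}"
  obtain CT where CT: "\<And>x. x \<in> X \<Longrightarrow> norm (T x) \<le> CT * norm x" using T_bounded by blast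
  have S_step: "S k \<in> H \<and> (\<forall>j<n. y (S k) j = T (y k j))" if k: "k \<in> H" for k
  proof -
    have "(\<exists>C::nat. eventually (\<lambda>i. norm (orb (S k) j i) \<le> real C) F) \<and> y (S k) j = T (y k j)" if j: "j < n" for j
    proof -
      obtain C :: nat where C: "eventually (\<lambda>i. norm (orb k j i) \<le> real C) F"
        using k j by (auto simp: H_def)
      have orb_S: "orb (S k) j = (\<lambda>i. T (orb k j i))"
        using j by (simp add: orb_def S_def box_shift_def fun_eq_iff)
      obtain C' :: nat where C': "\<bar>CT\<bar> * real C \<le> real C'" using real_arch_simple by blast
      have bd: "eventually (\<lambda>i. norm (T (orb k j i)) \<le> real C') F"
        using C
      proof eventually_elim
        case (elim i)
        have "norm (T (orb k j i)) \<le> CT * norm (orb k j i)" using CT orb_X by blast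
        also have "\<dots> \<le> \<bar>CT\<bar> * real C" using elim by (intro mult_mono) auto
        finally show ?case using C' by simp
      qed
      have "y (S k) j = T (y k j)"
        unfolding y_def orb_S by (rule weak_lim_T[OF F(1) orb_X C bd])
      then show ?thesis using bd orb_S by auto
    qed
    then show ?thesis by (auto simp: H_def)
  qed
  have S_iter: "(S ^^ t) k \<in> H \<and> (\<forall>j<n. y ((S ^^ t) k) j = (T ^^ t) (y k j))" if k: "k \<in> H" for k t
    by (induction t) (use k S_step in auto)
  have y_X: "y k j \<in> X" if "k \<in> H" "j < n" for k j
    using that weak_lim(1)[OF F(1), of "orb k j", OF orb_X] unfolding y_def H_def by blast

  have ev_sets: "{k. eventually (\<lambda>i. Q (k i) i) F} \<in> sets loeb" for Q
    using internal_in_sets[of "\<lambda>i. {a. Q a i}"] by (simp add: internal_def)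
  have H_sets: "H \<in> sets loeb"
  proof -
    have "H = (\<Inter>j\<in>{..<n}. \<Union>C::nat. {k. eventually (\<lambda>i. norm (orb k j i) \<le> real C) F})"
      by (auto simp: H_def)
    also have "\<dots> \<in> sets loeb"
    proof (cases "n = 0")
      case True
      then show ?thesis using sets.top[of loeb] by simp
    next
      case False
      then show ?thesis
        unfolding orb_def
        using ev_sets by (intro sets.finite_INT sets.countable_UN) auto
    qed
    finally show ?thesis .
  qed
  \<comment> \<open>A product of closed balls, with centres and radii given by \<open>q\<close>, seen in the space of times.\<close>
  define B where "B q = {k \<in> H. \<forall>j\<in>{..<n}. norm (y k j - fst (q j)) \<le> snd (q j)}" for q :: "nat \<Rightarrow> 'v \<times> real"
  have B_sets: "B q \<in> sets loeb" if q: "\<And>j. j < n \<Longrightarrow> fst (q j) \<in> X \<and> 0 \<le> snd (q j)" for q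
  proof -
    obtain D where D: "countable D" "D \<subseteq> E" "\<And>d. d \<in> D \<Longrightarrow> norm d \<le> 1"
      "\<And>x r. x \<in> X \<Longrightarrow> 0 \<le> r \<Longrightarrow> (\<And>d. d \<in> D \<Longrightarrow> norm (pair x d) \<le> r) \<Longrightarrow> norm x \<le> r"
      using countable_norming by blast
    define Q where "Q j d p = {k. eventually (\<lambda>i. norm (pair (orb k j i - fst (q j)) d)
        \<le> snd (q j) + 1 / real (Suc p)) F}" for j d and p :: nat
    have Q_sets: "Q j d p \<in> sets loeb" for j d p
      unfolding Q_def orb_def by (rule ev_sets)
    have iff: "norm (y k j - fst (q j)) \<le> snd (q j) \<longleftrightarrow> (\<forall>d\<in>D. \<forall>p. k \<in> Q j d p)"
      if k: "k \<in> H" and j: "j < n" for k j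
    proof -
      obtain C :: nat where C: "eventually (\<lambda>i. norm (orb k j i) \<le> real C) F"
        using k j by (auto simp: H_def)
      show ?thesis
        unfolding y_def Q_def mem_Collect_eq
        by (rule weak_lim_in_cball_iff[OF F(1), of "orb k j", OF orb_X C _ _ D(2,4,3)]) (use q[OF j] in auto)
    qed
    have "B q = {k \<in> space loeb. k \<in> H \<and> (\<forall>j\<in>{..<n}. \<forall>d\<in>D. \<forall>p. k \<in> Q j d p)}"
      using iff by (auto simp: B_def)
    also have "\<dots> \<in> sets loeb"
      using D(1) H_sets Q_sets
      by (intro sets.sets_Collect_conj sets.sets_Collect_countable_All'
          sets.sets_Collect_countable_All) auto
    finally show ?thesis .
  qed
  \<comment> \<open>Every neighbourhood of a point of \<open>X\<^sup>n\<close> contains one of these countably many products of balls around the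
    point.  Outside a null set, recurrence holds for all of them at once.\<close>
  define I where "I = PiE {..<n} (\<lambda>_. dense_set \<times> range (\<lambda>p. 1 / real (Suc p)))"
  have I_countable: "countable I"
    unfolding I_def by (intro countable_PiE countable_SIGMA dense_set(1)) auto
  have I_B: "B q \<in> sets loeb" if "q \<in> I" for q
  proof (rule B_sets)
    fix j assume "j < n"
    then have "q j \<in> dense_set \<times> range (\<lambda>p. 1 / real (Suc p))" using that by (auto simp: I_def PiE_iff)
    then show "fst (q j) \<in> X \<and> 0 \<le> snd (q j)" using dense_set(2) by auto
  qed
  have AE_B: "AE k in loeb. \<forall>q\<in>I. k \<in> B q \<longrightarrow> 0 < lower_density (return_set S k (B q))"
    using I_countable
  proof (rule AE_ball_countable[THEN iffD2, rule_format])
    show "AE k in loeb. k \<in> B q \<longrightarrow> 0 < lower_density (return_set S k (B q))" if "q \<in> I" for q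
      using finite_measure.recurrence_positive_frequency[OF finite_measure_loeb shift I_B[OF that]] .
  qed

  \<comment> \<open>At the points of \<open>G\<close> the limit lies in the prescribed product of closed balls.\<close>
  define G where "G = internal (\<lambda>i. {a. \<forall>j<n. a j \<in> A j})"
  have G_pos: "0 < emeasure loeb G"
  proof -
    have "(\<Prod>j<n. \<delta> j) \<le> ratio {a. \<forall>j<n. a j \<in> A j} i" for i
    proof -
      have "{a. \<forall>j<n. a j \<in> A j} \<inter> W i = PiE {..<n} (\<lambda>j. A j \<inter> {m i j..m i j + N i j})"
        by (auto simp: W_def PiE_iff)
      then have "ratio {a. \<forall>j<n. a j \<in> A j} i =
          (\<Prod>j<n. real (card (A j \<inter> {m i j..m i j + N i j})) / real (N i j + 1))"
        unfolding ratio_def W_def by (simp add: card_PiE prod_dividef)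
      moreover have "(\<Prod>j<n. \<delta> j) \<le> (\<Prod>j<n. real (card (A j \<inter> {m i j..m i j + N i j})) / real (N i j + 1))"
      proof (rule prod_mono, intro conjI)
        fix j assume "j \<in> {..<n}"
        then have j: "j < n" by simp
        show "0 \<le> \<delta> j" using \<delta>[OF j] by simp
        show "\<delta> j \<le> real (card (A j \<inter> {m i j..m i j + N i j})) / real (N i j + 1)"
          by (subst pos_le_divide_eq) (use Nm(2)[OF j] in auto)
      qed
      ultimately show ?thesis by simp
    qed
    then have "(\<Prod>j<n. \<delta> j) \<le> limit_ratio (\<lambda>i. {a. \<forall>j<n. a j \<in> A j})"
      by (intro limit_ratio_ge always_eventually) blast
    moreover have "0 < (\<Prod>j<n. \<delta> j)" using \<delta> by (intro prod_pos) auto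
    ultimately show ?thesis unfolding G_def emeasure_loeb by simp
  qed
  have "\<exists>k\<in>G. \<forall>q\<in>I. k \<in> B q \<longrightarrow> 0 < lower_density (return_set S k (B q))"
  proof (rule ccontr)
    assume "\<not> ?thesis"
    then have "AE k in loeb. k \<notin> G" using AE_B by (auto elim!: eventually_mono)
    then have "G \<in> null_sets loeb"
      using AE_iff_null_sets[of G loeb] internal_in_sets unfolding G_def by blast
    then show False using G_pos by auto
  qed
  then obtain k where kG: "k \<in> G"
    and k_rec: "\<And>q. q \<in> I \<Longrightarrow> k \<in> B q \<Longrightarrow> 0 < lower_density (return_set S k (B q))" by blast
  have near: "eventually (\<lambda>i. norm (orb k j i - u j) \<le> r j) F" if j: "j < n" for j
  proof -
    have "eventually (\<lambda>i. \<forall>j<n. k i j \<in> A j) F" using kG by (simp add: G_def internal_def)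
    then show ?thesis
      by eventually_elim
        (use j in \<open>auto simp: A_def return_set_def orb_def dist_norm norm_minus_commute less_imp_le\<close>)
  qed
  have kH: "k \<in> H"
  proof -
    have "\<exists>C::nat. eventually (\<lambda>i. norm (orb k j i) \<le> real C) F" if j: "j < n" for j
    proof -
      obtain C :: nat where C: "r j + norm (u j) \<le> real C" using real_arch_simple by blast
      have "eventually (\<lambda>i. norm (orb k j i) \<le> real C) F"
        using near[OF j]
      proof eventually_elim
        case (elim i)
        then show ?case using norm_triangle_ineq[of "orb k j i - u j" "u j"] C by simp
      qed
      then show ?thesis by blast
    qed
    then show ?thesis by (simp add: H_def)
  qed
  define f where "f = restrict (y k) {..<n}"
  have f_j: "f j = y k j" if "j < n" for j using that by (simp add: f_def)
  have f_ext: "f \<in> extensional {..<n}" by (simp add: f_def)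
  show thesis
  proof (rule that)
    have "y k j \<in> V j" if j: "j < n" for j
    proof -
      have "norm (y k j - u j) \<le> r j"
        unfolding y_def using near[OF j] r(1)[OF j]
        by (intro weak_lim_in_cball[OF F(1), of "orb k j", OF orb_X uV(2)[OF j]]) auto
      then have "y k j \<in> X \<inter> cball (u j) (r j)"
        using y_X[OF kH j] by (simp add: dist_norm norm_minus_commute)
      then show ?thesis using r(2)[OF j] by blast
    qed
    then have "f \<in> PiE {..<n} V" by (simp add: f_def)
    then show "f \<in> U" using V(3) by blast
  next
    fix N assume "neighbourhood_in ?P f N"
    then obtain O' where O': "openin ?P O'" "f \<in> O'" "O' \<subseteq> N" by (auto simp: neighbourhood_in_def)
    obtain V' where V': "\<And>j. j < n \<Longrightarrow> openin (top_of_set X) (V' j)" "f \<in> PiE {..<n} V'" "PiE {..<n} V' \<subseteq> O'"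
      by (rule power_topology_box[OF O'(1,2)]) blast
    have "\<exists>c p. c \<in> dense_set \<and> norm (y k j - c) \<le> 1 / real (Suc p) \<and> X \<inter> cball c (1 / real (Suc p)) \<subseteq> V' j"
      if j: "j < n" for j
    proof -
      have "y k j \<in> V' j" using PiE_mem[OF V'(2), of j] j f_j[OF j] by simp
      then show ?thesis by (rule dense_cball[OF V'(1)[OF j]]) blast
    qed
    then obtain c p where cp: "\<And>j. j < n \<Longrightarrow> c j \<in> dense_set"
      "\<And>j. j < n \<Longrightarrow> norm (y k j - c j) \<le> 1 / real (Suc (p j))"
      "\<And>j. j < n \<Longrightarrow> X \<inter> cball (c j) (1 / real (Suc (p j))) \<subseteq> V' j"
      by metis
    define q where "q = (\<lambda>j\<in>{..<n}. (c j, 1 / real (Suc (p j))))"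
    have qI: "q \<in> I" using cp(1) by (auto simp: q_def I_def)
    have "k \<in> B q" using kH cp(2) by (simp add: B_def q_def)
    from k_rec[OF qI this] have "0 < lower_density (return_set S k (B q))" .
    moreover have "return_set S k (B q) \<subseteq> return_set (direct_sum_power n T) f N"
    proof
      fix t assume "t \<in> return_set S k (B q)"
      then have t: "(S ^^ t) k \<in> B q" by (simp add: return_set_def)
      have "(T ^^ t) (f j) \<in> V' j" if j: "j < n" for j
      proof -
        have "norm ((T ^^ t) (y k j) - c j) \<le> 1 / real (Suc (p j))"
          using t j S_iter[OF kH, of t] by (auto simp: B_def q_def)
        then have "(T ^^ t) (y k j) \<in> X \<inter> cball (c j) (1 / real (Suc (p j)))"
          using funpow_mem[OF y_X[OF kH j]] by (simp add: dist_norm norm_minus_commute)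
        then show ?thesis using cp(3)[OF j] f_j[OF j] by auto
      qed
      then have "(direct_sum_power n T ^^ t) f \<in> PiE {..<n} V'"
        unfolding direct_sum_power_funpow[OF f_ext] by auto
      then show "t \<in> return_set (direct_sum_power n T) f N"
        using V'(3) O'(3) by (auto simp: return_set_def)
    qed
    ultimately show "0 < lower_density (return_set (direct_sum_power n T) f N)"
      using lower_density_mono less_le_trans by blast
  qed
qed

end

section \<open>Positive upper Banach density and thick sets\<close>

lemma upper_Banach_density_pos_unbounded:
  assumes "0 < upper_Banach_density A"
  obtains b where "b \<in> A" "K \<le> b"
proof -
  obtain \<delta> where \<delta>: "0 < \<delta>"
    and w: "\<And>L. \<exists>N\<ge>L. \<exists>m. \<delta> * real (N + 1) \<le> real (card (A \<inter> {m..m+N}))"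
    using assms unfolding upper_Banach_density_pos_iff by blast
  obtain L :: nat where L: "real K / \<delta> < real L" using reals_Archimedean2 by blast
  obtain N m where N: "L \<le> N" "\<delta> * real (N + 1) \<le> real (card (A \<inter> {m..m+N}))" using w by blast
  have "\<exists>b\<in>A. K \<le> b"
  proof (rule ccontr)
    assume "\<not> ?thesis"
    then have "A \<inter> {m..m+N} \<subseteq> {..<K}" by force
    then have "card (A \<inter> {m..m+N}) \<le> K" using card_mono[of "{..<K}"] by fastforce
    then have "\<delta> * real (N + 1) \<le> real K" using N(2) by linarith
    moreover have "real K < \<delta> * real L" using L \<delta> by (simp add: field_simps)
    moreover have "\<delta> * real L \<le> \<delta> * real (N + 1)" using N(1) \<delta> by (intro mult_left_mono) auto
    ultimately show False by linarith
  qed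
  then show thesis using that by blast
qed

text \<open>
  Thickness yields \<open>s 0 < s 1 < \<dots>\<close> all of whose differences \<open>s j - s i\<close> lie in \<open>J\<close> after adding \<open>q\<close>.  More than
  \<open>1 / \<delta>\<close> translates of a set of density \<open>\<delta>\<close> cannot be disjoint, and a common point of the translates by
  \<open>s i\<close> and \<open>s j\<close> exhibits \<open>s j - s i\<close> as a difference of elements of the set.
\<close>

lemma difference_in_thick_set:
  assumes A: "0 < upper_Banach_density A"
    and thick: "\<And>L K. \<exists>m\<ge>K. \<forall>j\<le>L. m - j \<in> J"
  obtains a b where "a \<in> A" "b \<in> A" "a < b" "b - a + q \<in> J"
proof -
  obtain \<delta> where \<delta>: "0 < \<delta>"
    and w: "\<And>L. \<exists>N\<ge>L. \<exists>m. \<delta> * real (N + 1) \<le> real (card (A \<inter> {m..m+N}))"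
    using A unfolding upper_Banach_density_pos_iff by blast
  have "\<exists>s'>s. \<forall>j\<le>s. s' + q - j \<in> J" for s
  proof -
    obtain m where "m \<ge> s + q + 1" "\<forall>j\<le>s. m - j \<in> J" using thick by blast
    then show ?thesis by (intro exI[of _ "m - q"]) auto
  qed
  then obtain g where g: "\<And>s. s < g s" "\<And>s j. j \<le> s \<Longrightarrow> g s + q - j \<in> J" by metis
  define s where "s i = (g ^^ i) 0" for i
  have s_Suc: "s (Suc i) = g (s i)" for i by (simp add: s_def)
  have s_mono: "strict_mono s" unfolding strict_mono_Suc_iff s_Suc using g(1) by blast
  have s_J: "s j - s i + q \<in> J" if ij: "i < j" for i j
  proof -
    obtain k where k: "j = Suc k" using ij by (cases j) auto
    have "s i \<le> s k" using s_mono ij k by (simp add: strict_mono_less_eq)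
    moreover have "s i < s j" using s_mono ij by (simp add: strict_mono_less)
    ultimately show ?thesis using g(2)[of "s i" "s k"] by (simp add: k s_Suc)
  qed
  obtain R :: nat where R: "2 / \<delta> < real R" using reals_Archimedean2 by blast
  obtain N m where N: "s R \<le> N" "\<delta> * real (N + 1) \<le> real (card (A \<inter> {m..m+N}))" using w by blast
  define B where "B i = (\<lambda>a. a + s i) ` (A \<inter> {m..m+N})" for i
  have card_B: "card (B i) = card (A \<inter> {m..m+N})" for i
    unfolding B_def by (intro card_image) (auto simp: inj_on_def)
  have "\<exists>i<R. \<exists>j<R. i \<noteq> j \<and> B i \<inter> B j \<noteq> {}"
  proof (rule ccontr)
    assume "\<not> ?thesis"
    then have disj: "\<forall>i\<in>{..<R}. \<forall>j\<in>{..<R}. i \<noteq> j \<longrightarrow> B i \<inter> B j = {}" by blast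
    have "(\<Union>i<R. B i) \<subseteq> {m..m+N+s R}"
      using s_mono by (fastforce simp: B_def strict_mono_less intro: add_mono less_imp_le)
    then have "card (\<Union>i<R. B i) \<le> N + 1 + s R"
      using card_mono[of "{m..m+N+s R}" "\<Union>i<R. B i"] by simp
    moreover have "card (\<Union>i<R. B i) = (\<Sum>i<R. card (B i))"
      using disj by (intro card_UN_disjoint) (auto simp: B_def)
    ultimately have "R * card (A \<inter> {m..m+N}) \<le> N + 1 + s R" by (simp add: card_B)
    then have "real R * real (card (A \<inter> {m..m+N})) \<le> real (N + 1 + s R)"
      by (simp only: of_nat_mult[symmetric] of_nat_le_iff)
    moreover have "real R * (\<delta> * real (N + 1)) \<le> real R * real (card (A \<inter> {m..m+N}))"
      using N(2) by (intro mult_left_mono) auto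
    moreover have "2 * real (N + 1) < (real R * \<delta>) * real (N + 1)"
      using R \<delta> by (intro mult_strict_right_mono) (auto simp: field_simps)
    ultimately have "2 * real (N + 1) < real (N + 1 + s R)" by (simp add: mult.assoc)
    then show False using N(1) by simp
  qed
  then have "\<exists>i j. i < j \<and> B i \<inter> B j \<noteq> {}"
    by (metis Int_commute nat_neq_iff)
  then obtain i j a b where ij: "i < j" "a \<in> A" "b \<in> A" "b + s i = a + s j"
    by (auto simp: B_def)
  have "s i < s j" using s_mono ij(1) by (simp add: strict_mono_less)
  then have "a < b" "b - a = s j - s i" using ij(4) by auto
  then show thesis using that ij s_J[OF ij(1)] by metis
qed

section \<open>Transitivity of the direct sums\<close>

context adjoint_system
begin

lemma T_diff:
  assumes "x \<in> X" "y \<in> X" shows "T (x - y) = T x - T y"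
  using T_add[of "x - y" y] diff_mem assms by simp

lemma add_mem: "x \<in> X \<Longrightarrow> y \<in> X \<Longrightarrow> x + y \<in> X"
  using subspace_X by (rule subspace_add)

lemma funpow_T_add:
  assumes "x \<in> X" "y \<in> X" shows "(T ^^ k) (x + y) = (T ^^ k) x + (T ^^ k) y"
  by (induction k) (auto simp: T_add funpow_mem assms)

lemma funpow_T_diff:
  assumes "x \<in> X" "y \<in> X" shows "(T ^^ k) (x - y) = (T ^^ k) x - (T ^^ k) y"
  by (induction k) (auto simp: T_diff funpow_mem assms)

lemma growth_bound:
  obtains C where "1 \<le> C" "\<And>x k. x \<in> X \<Longrightarrow> norm ((T ^^ k) x) \<le> C ^ k * norm x"
proof -
  obtain C0 where C0: "\<And>x. x \<in> X \<Longrightarrow> norm (T x) \<le> C0 * norm x" using T_bounded by blast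
  define C where "C = max 1 C0"
  have C: "norm (T x) \<le> C * norm x" if "x \<in> X" for x
    using C0[OF that] mult_right_mono[of C0 C "norm x"] by (simp add: C_def)
  have "norm ((T ^^ k) x) \<le> C ^ k * norm x" if "x \<in> X" for x k
  proof (induction k)
    case (Suc k)
    have "norm ((T ^^ Suc k) x) \<le> C * norm ((T ^^ k) x)" using C funpow_mem[OF that] by simp
    also have "\<dots> \<le> C * (C ^ k * norm x)" using Suc.IH by (intro mult_left_mono) (auto simp: C_def)
    finally show ?case by simp
  qed simp
  then show thesis using that[of C] by (simp add: C_def)
qed

lemma continuous_T: "continuous_map (top_of_set X) (top_of_set X) T"
proof -
  obtain C where C: "1 \<le> C" "\<And>x k. x \<in> X \<Longrightarrow> norm ((T ^^ k) x) \<le> C ^ k * norm x"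
    using growth_bound by blast
  have "norm (T x) \<le> C * norm x" if "x \<in> X" for x using C(2)[OF that, of 1] by simp
  then have "dist (T x) (T y) \<le> C * dist x y" if "x \<in> X" "y \<in> X" for x y
    using that T_diff diff_mem by (simp add: dist_norm flip: T_diff)
  then have "C-lipschitz_on X T" using C(1) by (intro lipschitz_onI) auto
  then have "continuous_on X T" by (rule lipschitz_on_continuous_on)
  then show ?thesis using T_mem by auto
qed

text \<open>
  The set \<open>J\<close> of times carrying a small vector close to \<open>x\<close> is thick: if \<open>v\<close> is so small that
  \<open>v, T v, \<dots>, T\<^sup>L v\<close> are all small and \<open>T\<^sup>m v\<close> is close to \<open>x\<close>, then \<open>m - L, \<dots>, m\<close> all belong to \<open>J\<close>.
  If \<open>T\<^sup>q x\<close> is small and the orbit of \<open>x\<close> is close to \<open>x\<close> at the times \<open>a < b\<close>, then \<open>b - a + q\<close> steps carry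
  \<open>T\<^sup>a x\<close>, a point close to \<open>x\<close>, to the small vector \<open>T\<^sup>q (T\<^sup>b x)\<close>.  For suitable \<open>a\<close> and \<open>b\<close> this
  number of steps lies in \<open>J\<close>, because differences meet translates of thick sets.
\<close>

lemma small_orbit_pair:
  assumes x: "x \<in> X"
    and hyp: "\<And>U. openin (top_of_set X) U \<Longrightarrow> U \<noteq> {} \<Longrightarrow> 0 < upper_Banach_density (return_set T x U)"
    and \<eta>: "0 < \<eta>"
  obtains n u w where "u \<in> X" "w \<in> X" "norm (u - x) < \<eta>" "norm ((T ^^ n) u) < \<eta>"
    "norm w < \<eta>" "norm ((T ^^ n) w - x) < \<eta>"
proof -
  obtain C where C: "1 \<le> C" "\<And>x k. x \<in> X \<Longrightarrow> norm ((T ^^ k) x) \<le> C ^ k * norm x"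
    using growth_bound by blast
  have C_pos: "0 < C ^ k" for k using C(1) by simp
  have ret: "0 < upper_Banach_density (return_set T x (X \<inter> ball c e))" if "c \<in> X" "0 < e" for c e
    using that by (intro hyp) (auto simp: openin_open_Int)
  have hits: "\<exists>k\<ge>K. (T ^^ k) x \<in> ball c e" if "c \<in> X" "0 < e" for c e K
    using upper_Banach_density_pos_unbounded[OF ret[OF that], of K] by (auto simp: return_set_def)
  have zero: "0 \<in> X" using subspace_X by (rule subspace_0)
  define J where "J = {n. \<exists>w\<in>X. norm w < \<eta> \<and> norm ((T ^^ n) w - x) < \<eta>}"
  have thick: "\<exists>m\<ge>K. \<forall>j\<le>L. m - j \<in> J" for L K
  proof -
    obtain a where a: "(T ^^ a) x \<in> ball 0 (\<eta> / C ^ L)"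
      using hits[OF zero, of "\<eta> / C ^ L" 0] \<eta> C_pos by auto
    obtain b where b: "b \<ge> a + L + K" "(T ^^ b) x \<in> ball x \<eta>"
      using hits[OF x \<eta>] by blast
    have "b - a - j \<in> J" if j: "j \<le> L" for j
    proof -
      let ?w = "(T ^^ j) ((T ^^ a) x)"
      have "norm ?w \<le> C ^ j * norm ((T ^^ a) x)" using C(2) funpow_mem[OF x] by blast
      also have "\<dots> \<le> C ^ L * norm ((T ^^ a) x)"
        using C(1) j by (intro mult_right_mono power_increasing) auto
      also have "\<dots> < \<eta>" using a C_pos[of L] by (simp add: field_simps)
      finally have "norm ?w < \<eta>" .
      moreover have "(T ^^ (b - a - j)) ?w = (T ^^ b) x"
        using b(1) j by (simp flip: funpow_apply_add)
      ultimately show ?thesis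
        using b(2) funpow_mem[OF funpow_mem[OF x]]
        by (auto simp: J_def dist_norm norm_minus_commute intro!: bexI[of _ ?w])
    qed
    then show ?thesis using b(1) by (intro exI[of _ "b - a"]) auto
  qed
  obtain q where q: "norm ((T ^^ q) x) < \<eta> / 2"
    using hits[OF zero, of "\<eta> / 2" 0] \<eta> by auto
  define e where "e = \<eta> / (2 * C ^ q)"
  have e: "0 < e" "C ^ q * e = \<eta> / 2" using \<eta> C_pos[of q] C(1) by (auto simp: e_def)
  have e_le: "e \<le> \<eta>"
  proof -
    have "1 * \<eta> \<le> (2 * C ^ q) * \<eta>"
      using \<eta> one_le_power[OF C(1), of q] by (intro mult_right_mono) auto
    then show ?thesis using C_pos[of q] by (simp add: e_def field_simps)
  qed
  obtain a b where ab: "a \<in> return_set T x (X \<inter> ball x e)" "b \<in> return_set T x (X \<inter> ball x e)"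
    "a < b" "b - a + q \<in> J"
    using difference_in_thick_set[OF ret[OF x e(1)] thick] by blast
  obtain w where w: "w \<in> X" "norm w < \<eta>" "norm ((T ^^ (b - a + q)) w - x) < \<eta>"
    using ab(4) by (auto simp: J_def)
  have eq: "(T ^^ (b - a + q)) ((T ^^ a) x) = (T ^^ q) ((T ^^ b) x)"
    using ab(3) by (simp flip: funpow_apply_add)
  have "norm ((T ^^ q) ((T ^^ b) x)) \<le> norm ((T ^^ q) x) + norm ((T ^^ q) ((T ^^ b) x) - (T ^^ q) x)"
    by (rule norm_triangle_sub)
  also have "\<dots> \<le> norm ((T ^^ q) x) + C ^ q * norm ((T ^^ b) x - x)"
    using C(2)[of "(T ^^ b) x - x" q] diff_mem funpow_mem x by (simp add: funpow_T_diff)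
  also have "\<dots> < \<eta> / 2 + C ^ q * e"
    using q ab(2) C_pos[of q]
    by (intro add_strict_mono mult_strict_left_mono) (auto simp: return_set_def dist_norm norm_minus_commute)
  finally have "norm ((T ^^ (b - a + q)) ((T ^^ a) x)) < \<eta>" using e eq by simp
  moreover have "norm ((T ^^ a) x - x) < \<eta>"
    using ab(1) e_le by (auto simp: return_set_def dist_norm norm_minus_commute)
  ultimately show thesis using that[of "(T ^^ a) x" w "b - a + q"] w funpow_mem[OF x] by blast
qed

text \<open>
  Choose \<open>q j\<close> and \<open>p j\<close> such that \<open>T\<close> moves \<open>x\<close> close to \<open>u j\<close> and to \<open>v j\<close> in that many steps.  With \<open>a\<close> and \<open>w\<close> from
  \<open>small_orbit_pair\<close>, the \<open>j\<close>-th coordinate \<open>(T ^^ q j) a + (T ^^ p j) w\<close> is close to \<open>u j\<close>, and its image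
  under \<open>T\<^sup>k\<close> is close to \<open>v j\<close>; one exponent \<open>k\<close> serves all coordinates.
\<close>

lemma power_transitive:
  assumes x: "x \<in> X"
    and hyp: "\<And>U. openin (top_of_set X) U \<Longrightarrow> U \<noteq> {} \<Longrightarrow> 0 < upper_Banach_density (return_set T x U)"
    and U: "openin (power_topology n (top_of_set X)) U" "u \<in> U"
    and V: "openin (power_topology n (top_of_set X)) V" "v \<in> V"
  obtains z k where "z \<in> U" "(direct_sum_power n T ^^ k) z \<in> V"
proof -
  obtain C where C: "1 \<le> C" "\<And>x k. x \<in> X \<Longrightarrow> norm ((T ^^ k) x) \<le> C ^ k * norm x"
    using growth_bound by blast
  have C_pos: "0 < C ^ k" for k using C(1) by simp
  obtain U' where U': "\<And>j. j < n \<Longrightarrow> openin (top_of_set X) (U' j)" "u \<in> PiE {..<n} U'" "PiE {..<n} U' \<subseteq> U"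
    by (rule power_topology_box[OF U]) blast
  obtain V' where V': "\<And>j. j < n \<Longrightarrow> openin (top_of_set X) (V' j)" "v \<in> PiE {..<n} V'" "PiE {..<n} V' \<subseteq> V"
    by (rule power_topology_box[OF V]) blast
  have "\<exists>r>0. X \<inter> cball (u j) r \<subseteq> U' j \<and> X \<inter> cball (v j) r \<subseteq> V' j" if j: "j < n" for j
  proof -
    obtain r1 where r1: "0 < r1" "X \<inter> cball (u j) r1 \<subseteq> U' j"
      using open_in_subspace_cball[OF U'(1)[OF j]] PiE_mem[OF U'(2), of j] j by auto
    obtain r2 where r2: "0 < r2" "X \<inter> cball (v j) r2 \<subseteq> V' j"
      using open_in_subspace_cball[OF V'(1)[OF j]] PiE_mem[OF V'(2), of j] j by auto
    show ?thesis
      using r1 r2 by (intro exI[of _ "min r1 r2"]) auto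
  qed
  then obtain r where r: "\<And>j. j < n \<Longrightarrow> 0 < r j" "\<And>j. j < n \<Longrightarrow> X \<inter> cball (u j) (r j) \<subseteq> U' j"
    "\<And>j. j < n \<Longrightarrow> X \<inter> cball (v j) (r j) \<subseteq> V' j"
    by metis
  have uX: "u j \<in> X" and vX: "v j \<in> X" if j: "j < n" for j
    using openin_subset[OF U'(1)[OF j]] openin_subset[OF V'(1)[OF j]]
      PiE_mem[OF U'(2), of j] PiE_mem[OF V'(2), of j] j by auto
  have hits: "\<exists>k. norm ((T ^^ k) x - c) < e" if "c \<in> X" "0 < e" for c e
  proof -
    have "0 < upper_Banach_density (return_set T x (X \<inter> ball c e))"
      using that by (intro hyp) (auto simp: openin_open_Int)
    from upper_Banach_density_pos_unbounded[OF this, of 0] show ?thesis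
      by (auto simp: return_set_def dist_norm norm_minus_commute)
  qed
  have "\<exists>q p. norm ((T ^^ q) x - u j) < r j / 3 \<and> norm ((T ^^ p) x - v j) < r j / 3" if j: "j < n" for j
    using hits[OF uX[OF j], of "r j / 3"] hits[OF vX[OF j], of "r j / 3"] r(1)[OF j] by auto
  then obtain q p where qp: "\<And>j. j < n \<Longrightarrow> norm ((T ^^ (q j)) x - u j) < r j / 3"
    "\<And>j. j < n \<Longrightarrow> norm ((T ^^ (p j)) x - v j) < r j / 3"
    by metis
  define \<eta> where "\<eta> = Min (insert 1 ((\<lambda>j. r j / (3 * C ^ (q j + p j))) ` {..<n}))"
  have \<eta>: "0 < \<eta>" unfolding \<eta>_def using r(1) C_pos by (subst Min_gr_iff) auto
  have small: "C ^ (q j) * \<eta> \<le> r j / 3" "C ^ (p j) * \<eta> \<le> r j / 3" if j: "j < n" for j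
  proof -
    have "\<eta> \<le> r j / (3 * C ^ (q j + p j))" unfolding \<eta>_def using j by (intro Min_le) auto
    then have *: "C ^ (q j + p j) * \<eta> \<le> r j / 3" using C_pos[of "q j + p j"] by (simp add: field_simps)
    have "C ^ (q j) * \<eta> \<le> C ^ (q j + p j) * \<eta>" "C ^ (p j) * \<eta> \<le> C ^ (q j + p j) * \<eta>"
      using C(1) \<eta> by (auto intro!: mult_right_mono power_increasing)
    with * show "C ^ (q j) * \<eta> \<le> r j / 3" "C ^ (p j) * \<eta> \<le> r j / 3" by linarith+
  qed
  obtain k a w where aw: "a \<in> X" "w \<in> X" "norm (a - x) < \<eta>" "norm ((T ^^ k) a) < \<eta>"
    "norm w < \<eta>" "norm ((T ^^ k) w - x) < \<eta>"
    using small_orbit_pair[OF x hyp \<eta>] by metis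
  have app: "norm ((T ^^ i) y) \<le> C ^ i * \<eta>" if "y \<in> X" "norm y < \<eta>" for y i
  proof -
    have "norm ((T ^^ i) y) \<le> C ^ i * norm y" using C(2) that by blast
    also have "\<dots> \<le> C ^ i * \<eta>" using that C_pos[of i] by (intro mult_left_mono) auto
    finally show ?thesis .
  qed
  define z where "z = (\<lambda>j\<in>{..<n}. (T ^^ (q j)) a + (T ^^ (p j)) w)"
  have z_ext: "z \<in> extensional {..<n}" by (simp add: z_def)
  have z_U: "z j \<in> U' j" if j: "j < n" for j
  proof -
    have "(T ^^ (q j)) a + (T ^^ (p j)) w - u j =
        (T ^^ (q j)) (a - x) + ((T ^^ (q j)) x - u j) + (T ^^ (p j)) w"
      using aw x by (simp add: funpow_T_diff)
    also have "norm \<dots> \<le> norm ((T ^^ (q j)) (a - x)) + norm ((T ^^ (q j)) x - u j) + norm ((T ^^ (p j)) w)"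
      by (meson add_mono norm_triangle_ineq norm_triangle_mono order_refl)
    also have "\<dots> \<le> r j / 3 + r j / 3 + r j / 3"
      using app[of "a - x" "q j"] app[of w "p j"] aw x diff_mem qp(1)[OF j] small[OF j] by fastforce
    finally have "norm (z j - u j) \<le> r j" using j by (simp add: z_def)
    moreover have "z j \<in> X" using j aw funpow_mem add_mem by (simp add: z_def)
    ultimately show ?thesis using r(2)[OF j] by (auto simp: dist_norm norm_minus_commute)
  qed
  have comm: "(T ^^ k) ((T ^^ i) y) = (T ^^ i) ((T ^^ k) y)" for i y
    by (metis funpow_apply_add add.commute)
  have z_V: "(T ^^ k) (z j) \<in> V' j" if j: "j < n" for j
  proof -
    have "(T ^^ k) (z j) - v j = (T ^^ (q j)) ((T ^^ k) a) +
        (T ^^ (p j)) ((T ^^ k) w - x) + ((T ^^ (p j)) x - v j)"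
      using j aw x by (simp add: z_def funpow_T_add funpow_T_diff funpow_mem comm)
    also have "norm \<dots> \<le> norm ((T ^^ (q j)) ((T ^^ k) a)) +
        norm ((T ^^ (p j)) ((T ^^ k) w - x)) + norm ((T ^^ (p j)) x - v j)"
      by (meson add_mono norm_triangle_ineq norm_triangle_mono order_refl)
    also have "\<dots> \<le> r j / 3 + r j / 3 + r j / 3"
      using app[of "(T ^^ k) a" "q j"] app[of "(T ^^ k) w - x" "p j"] aw x diff_mem funpow_mem
        qp(2)[OF j] small[OF j] by fastforce
    finally have "norm ((T ^^ k) (z j) - v j) \<le> r j" by simp
    moreover have "z j \<in> X" using j aw funpow_mem add_mem by (simp add: z_def)
    ultimately show ?thesis using r(3)[OF j] funpow_mem by (auto simp: dist_norm norm_minus_commute)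
  qed
  have "z \<in> PiE {..<n} U'" using z_ext z_U by (auto simp: PiE_iff)
  moreover have "(direct_sum_power n T ^^ k) z \<in> PiE {..<n} V'"
    unfolding direct_sum_power_funpow[OF z_ext] using z_V by auto
  ultimately show thesis using that U'(3) V'(3) by blast
qed

section \<open>Reiterative hypercyclicity of the direct sums\<close>

lemma continuous_power:
  "continuous_map (power_topology n (top_of_set X)) (power_topology n (top_of_set X))
    (direct_sum_power n T ^^ k)"
proof (induction k)
  case (Suc k)
  have "continuous_map (power_topology n (top_of_set X)) (top_of_set X) (\<lambda>v. T (v j))" if "j < n" for j
  proof -
    have "continuous_map (power_topology n (top_of_set X)) (top_of_set X) (\<lambda>v. v j)"
      using that by (intro continuous_map_product_projection) simp
    from continuous_map_compose[OF this continuous_T] show ?thesis by (simp add: comp_def)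
  qed
  then have "continuous_map (power_topology n (top_of_set X)) (power_topology n (top_of_set X))
      (direct_sum_power n T)"
    unfolding continuous_map_componentwise by (auto simp: direct_sum_power_def)
  from continuous_map_compose[OF Suc.IH this] show ?case by (simp add: comp_def)
qed (simp add: id_def)

lemma completely_metrizable_power: "completely_metrizable_space (power_topology n (top_of_set X))"
proof -
  have "completely_metrizable_space (top_of_set X)"
    using closed_X completely_metrizable_space_closedin completely_metrizable_space_euclidean
    by (metis closed_closedin)
  moreover have "countable {i \<in> {..<n}. \<not> (\<exists>a. topspace (top_of_set X) \<subseteq> {a})}"
    by (intro countable_finite) auto
  ultimately show ?thesis unfolding completely_metrizable_space_product_topology by blast
qed

text \<open>
  Birkhoff's transitivity theorem: the points whose orbit meets a given set of a countable base form a
  dense open set.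
\<close>

lemma power_dense_orbit:
  assumes x: "x \<in> X"
    and hyp: "\<And>U. openin (top_of_set X) U \<Longrightarrow> U \<noteq> {} \<Longrightarrow> 0 < upper_Banach_density (return_set T x U)"
  obtains z where "z \<in> topspace (power_topology n (top_of_set X))"
    "\<And>U. openin (power_topology n (top_of_set X)) U \<Longrightarrow> U \<noteq> {} \<Longrightarrow> \<exists>k. (direct_sum_power n T ^^ k) z \<in> U"
proof -
  let ?P = "power_topology n (top_of_set X)" and ?S = "direct_sum_power n T"
  define I where "I = PiE {..<n} (\<lambda>_. dense_set \<times> range (\<lambda>p. 1 / real (Suc p)))"
  have I_countable: "countable I"
    unfolding I_def by (intro countable_PiE countable_SIGMA dense_set(1)) auto
  define box where "box q = PiE {..<n} (\<lambda>j. X \<inter> ball (fst (q j)) (snd (q j)))" for q :: "nat \<Rightarrow> 'v \<times> real"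
  define G where "G q = (\<Union>k. {z \<in> topspace ?P. (?S ^^ k) z \<in> box q})" for q
  have box_open: "openin ?P (box q)" for q
    unfolding box_def by (subst openin_PiE) (auto simp: openin_open_Int)
  have G_open: "openin ?P (G q)" for q
    unfolding G_def using openin_continuous_map_preimage[OF continuous_power box_open]
    by (intro openin_Union) auto
  have G_dense: "?P closure_of (G q) = topspace ?P" if q: "q \<in> I" for q
  proof -
    have "q j \<in> dense_set \<times> range (\<lambda>p. 1 / real (Suc p))" if "j < n" for j
      using q that by (auto simp: I_def PiE_iff)
    then have "fst (q j) \<in> X \<inter> ball (fst (q j)) (snd (q j))" if "j < n" for j
      using that dense_set(2) by (fastforce simp: mem_Times_iff)
    then have c: "(\<lambda>j\<in>{..<n}. fst (q j)) \<in> box q" by (simp add: box_def)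
    have "\<exists>z\<in>G q. z \<in> U" if "openin ?P U" "u \<in> U" for U u
    proof -
      obtain z k where "z \<in> U" "(?S ^^ k) z \<in> box q"
        using power_transitive[OF x hyp \<open>openin ?P U\<close> \<open>u \<in> U\<close> box_open c] by metis
      then show ?thesis using openin_subset[OF that(1)] by (auto simp: G_def)
    qed
    then show ?thesis by (auto simp: closure_of_def)
  qed
  have "?P closure_of (\<Inter>(G ` I)) = topspace ?P"
    using I_countable G_open G_dense completely_metrizable_power
    by (intro Baire_category) auto
  moreover have "(\<lambda>j\<in>{..<n}. x) \<in> topspace ?P" using x by simp
  ultimately have "(\<lambda>j\<in>{..<n}. x) \<in> ?P closure_of (\<Inter>(G ` I))" by (simp only:)
  then obtain z where z: "z \<in> \<Inter>(G ` I)" "z \<in> topspace ?P"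
    unfolding in_closure_of using openin_topspace by blast
  show thesis
  proof (rule that[OF z(2)])
    fix U assume U: "openin ?P U" "U \<noteq> {}"
    then obtain u where u: "u \<in> U" by blast
    obtain V where V: "\<And>j. j < n \<Longrightarrow> openin (top_of_set X) (V j)" "u \<in> PiE {..<n} V" "PiE {..<n} V \<subseteq> U"
      by (rule power_topology_box[OF U(1) u]) blast
    have "\<exists>c p. c \<in> dense_set \<and> X \<inter> cball c (1 / real (Suc p)) \<subseteq> V j" if j: "j < n" for j
      using dense_cball[OF V(1)[OF j]] PiE_mem[OF V(2), of j] j by (metis lessThan_iff)
    then obtain c p where cp: "\<And>j. j < n \<Longrightarrow> c j \<in> dense_set"
      "\<And>j. j < n \<Longrightarrow> X \<inter> cball (c j) (1 / real (Suc (p j))) \<subseteq> V j"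
      by metis
    define q where "q = (\<lambda>j\<in>{..<n}. (c j, 1 / real (Suc (p j))))"
    have "q \<in> I" using cp(1) by (auto simp: q_def I_def)
    then obtain k where "(?S ^^ k) z \<in> box q" using z(1) by (auto simp: G_def)
    moreover have "box q \<subseteq> PiE {..<n} V"
      unfolding box_def using cp(2) ball_subset_cball by (intro PiE_mono) (fastforce simp: q_def)
    ultimately show "\<exists>k. (?S ^^ k) z \<in> U" using V(3) by blast
  qed
qed

text \<open>
  Visits of a frequently recurrent point \<open>f\<close> to \<open>U\<close> during a window of times are shared by all points
  near \<open>f\<close>, in particular by a point on the dense orbit of \<open>z\<close>; so the orbit of \<open>z\<close> contains a translate of
  every window of visits of \<open>f\<close>.
\<close>

theorem power_reiteratively_hypercyclic:
  assumes "reiteratively_hypercyclic (top_of_set X) T"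
  shows "reiteratively_hypercyclic (power_topology n (top_of_set X)) (direct_sum_power n T)"
    and "frequently_recurrent (power_topology n (top_of_set X)) (direct_sum_power n T)"
proof -
  let ?P = "power_topology n (top_of_set X)" and ?S = "direct_sum_power n T"
  obtain x where x: "x \<in> X"
    and hyp: "\<And>U. openin (top_of_set X) U \<Longrightarrow> U \<noteq> {} \<Longrightarrow> 0 < upper_Banach_density (return_set T x U)"
    using assms by (auto simp: reiteratively_hypercyclic_def)
  obtain z where z: "z \<in> topspace ?P"
    "\<And>U. openin ?P U \<Longrightarrow> U \<noteq> {} \<Longrightarrow> \<exists>k. (?S ^^ k) z \<in> U"
    using power_dense_orbit[OF x hyp] by metis
  show "reiteratively_hypercyclic ?P ?S"
    unfolding reiteratively_hypercyclic_def
  proof (intro bexI[OF _ z(1)] allI impI)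
    fix U assume U: "openin ?P U \<and> U \<noteq> {}"
    obtain f where f: "f \<in> U" "\<And>N. neighbourhood_in ?P f N \<Longrightarrow> 0 < lower_density (return_set ?S f N)"
      using frequently_recurrent_point[OF assms] U by metis
    have "neighbourhood_in ?P f U"
      using U f(1) openin_subset[of ?P U] unfolding neighbourhood_in_def by blast
    then have "0 < upper_Banach_density (return_set ?S f U)"
      using f(2) lower_density_pos_imp_upper_Banach_density_pos by blast
    then obtain \<delta> where \<delta>: "0 < \<delta>"
      and w: "\<And>L. \<exists>N\<ge>L. \<exists>m. \<delta> * real (N + 1) \<le> real (card (return_set ?S f U \<inter> {m..m+N}))"
      unfolding upper_Banach_density_pos_iff by blast
    show "0 < upper_Banach_density (return_set ?S z U)"
      unfolding upper_Banach_density_pos_iff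
    proof (intro exI[of _ \<delta>] conjI allI \<delta>)
      fix L
      obtain N m where N: "L \<le> N" and m: "\<delta> * real (N + 1) \<le> real (card (return_set ?S f U \<inter> {m..m+N}))"
        using w by blast
      let ?t = "return_set ?S f U \<inter> {m..m+N}"
      define Q where "Q = (\<Inter>t\<in>?t. {g \<in> topspace ?P. (?S ^^ t) g \<in> U}) \<inter> topspace ?P"
      have "openin ?P Q"
        unfolding Q_def using openin_continuous_map_preimage[OF continuous_power] U
        by (intro openin_INT) blast+
      moreover have "f \<in> Q"
        using f(1) U openin_subset[of ?P U] by (auto simp only: Q_def return_set_def)
      ultimately obtain k where k: "(?S ^^ k) z \<in> Q" using z(2) by blast
      have "(\<lambda>t. k + t) ` ?t \<subseteq> return_set ?S z U \<inter> {k + m..k + m + N}"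
        using k by (auto simp: Q_def return_set_def funpow_apply_add)
      then have "card ((\<lambda>t. k + t) ` ?t) \<le> card (return_set ?S z U \<inter> {k + m..k + m + N})"
        by (intro card_mono) auto
      moreover have "card ((\<lambda>t. k + t) ` ?t) = card ?t"
        by (intro card_image) (auto simp: inj_on_def)
      ultimately have "\<delta> * real (N + 1) \<le> real (card (return_set ?S z U \<inter> {k + m..k + m + N}))"
        using m by linarith
      then show "\<exists>N\<ge>L. \<exists>m. \<delta> * real (N + 1) \<le> real (card (return_set ?S z U \<inter> {m..m+N}))"
        using N by blast
    qed
  qed
  show "frequently_recurrent ?P ?S"
    unfolding frequently_recurrent_def
  proof (rule antisym[OF closure_of_subset_topspace], rule subsetI)
    fix v assume v: "v \<in> topspace ?P"
    show "v \<in> ?P closure_of {x \<in> topspace ?P. \<forall>U. neighbourhood_in ?P x U \<longrightarrow>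
        0 < lower_density (return_set ?S x U)}"
      unfolding in_closure_of
    proof (intro conjI v allI impI)
      fix U assume U: "v \<in> U \<and> openin ?P U"
      obtain f where f: "f \<in> U" "\<And>N. neighbourhood_in ?P f N \<Longrightarrow> 0 < lower_density (return_set ?S f N)"
        using frequently_recurrent_point[OF assms, of n U] U by auto
      then show "\<exists>y. y \<in> {x \<in> topspace ?P. \<forall>U. neighbourhood_in ?P x U \<longrightarrow>
          0 < lower_density (return_set ?S x U)} \<and> y \<in> U"
        using openin_subset[of ?P U] U by blast
    qed
  qed
qed

end

section \<open>The Hahn-Banach theorem for norming functionals\<close>

text \<open>
  Homogeneity is asked for as an inequality, the form that passes to infima; equality follows in
  \<open>sublinear_scale\<close>.
\<close>

definition sublinear :: "('x::real_vector \<Rightarrow> real) \<Rightarrow> bool"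
  where "sublinear p \<longleftrightarrow> (\<forall>v w. p (v + w) \<le> p v + p w) \<and> (\<forall>t\<ge>0. \<forall>v. p (t *\<^sub>R v) \<le> t * p v)"

lemma sublinear_add: "sublinear p \<Longrightarrow> p (v + w) \<le> p v + p w"
  and sublinear_scale_le: "sublinear p \<Longrightarrow> 0 \<le> t \<Longrightarrow> p (t *\<^sub>R v) \<le> t * p v"
  by (auto simp: sublinear_def)

lemma sublinear_zero: "sublinear p \<Longrightarrow> p 0 = 0"
  using sublinear_add[of p 0 0] sublinear_scale_le[of p 0 0] by simp

lemma sublinear_scale:
  assumes p: "sublinear p" and t: "0 \<le> t" shows "p (t *\<^sub>R v) = t * p v"
proof (cases "t = 0")
  case False
  then have "p v \<le> inverse t * p (t *\<^sub>R v)"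
    using sublinear_scale_le[OF p, of "inverse t" "t *\<^sub>R v"] t by simp
  then have "t * p v \<le> p (t *\<^sub>R v)" using t False by (simp add: field_simps)
  then show ?thesis using sublinear_scale_le[OF p t, of v] by simp
qed (simp add: sublinear_zero[OF p])

lemma sublinear_minus: "sublinear p \<Longrightarrow> - p (- v) \<le> p v"
  using sublinear_add[of p v "- v"] sublinear_zero[of p] by simp

text \<open>
  The infimum over \<open>t \<ge> 0\<close> of \<open>p (v + t y) - t p(y)\<close> lowers \<open>p\<close> in the direction of \<open>y\<close>.  This is the only
  construction needed for the theorem of Hahn and Banach: it shows that a minimal sublinear function is
  additive, and it produces the function from which to start.
\<close>

lemma sublinear_lower:
  fixes p :: "'x::real_vector \<Rightarrow> real"
  assumes p: "sublinear p"
  obtains q where "sublinear q" "\<And>v. q v \<le> p v" "\<And>v. q v \<le> p (v + y) - p y"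
proof -
  define q where "q v = (INF t\<in>{0..}. p (v + t *\<^sub>R y) - t * p y)" for v
  have low: "- p (- v) \<le> p (v + t *\<^sub>R y) - t * p y" if "0 \<le> t" for v t
    using sublinear_add[OF p, of "v + t *\<^sub>R y" "- v"] sublinear_scale[OF p that, of y] by simp
  then have bdd: "bdd_below ((\<lambda>t. p (v + t *\<^sub>R y) - t * p y) ` {0..})" for v
    by (intro bdd_belowI2) auto
  have q_le: "q v \<le> p (v + t *\<^sub>R y) - t * p y" if "0 \<le> t" for v t
    unfolding q_def using bdd that by (intro cINF_lower) auto
  have q_ge: "c \<le> q v" if "\<And>t. 0 \<le> t \<Longrightarrow> c \<le> p (v + t *\<^sub>R y) - t * p y" for c v
    unfolding q_def using that by (intro cINF_greatest) auto
  have "sublinear q"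
    unfolding sublinear_def
  proof (intro conjI allI impI)
    fix v w
    have *: "q (v + w) \<le> (p (v + s *\<^sub>R y) - s * p y) + (p (w + t *\<^sub>R y) - t * p y)"
      if "0 \<le> s" "0 \<le> t" for s t
      using q_le[of "s + t" "v + w"] that sublinear_add[OF p, of "v + s *\<^sub>R y" "w + t *\<^sub>R y"]
      by (simp add: algebra_simps)
    have "q (v + w) - (p (w + t *\<^sub>R y) - t * p y) \<le> q v" if "0 \<le> t" for t
      using *[OF _ that] by (intro q_ge) (simp add: algebra_simps)
    then have "q (v + w) - q v \<le> q w" by (intro q_ge) (simp add: algebra_simps)
    then show "q (v + w) \<le> q v + q w" by simp
  next
    fix c :: real and v assume c: "0 \<le> c"
    show "q (c *\<^sub>R v) \<le> c * q v"
    proof (cases "c = 0")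
      case True
      then show ?thesis using q_le[of 0 0] sublinear_zero[OF p] by simp
    next
      case False
      have "q (c *\<^sub>R v) / c \<le> q v"
      proof (rule q_ge)
        fix t :: real assume t: "0 \<le> t"
        have "q (c *\<^sub>R v) \<le> p (c *\<^sub>R (v + t *\<^sub>R y)) - (c * t) * p y"
          using q_le[of "c * t" "c *\<^sub>R v"] c t by (simp add: scaleR_add_right)
        also have "\<dots> = c * (p (v + t *\<^sub>R y) - t * p y)"
          unfolding sublinear_scale[OF p c] by (simp add: algebra_simps)
        finally show "q (c *\<^sub>R v) / c \<le> p (v + t *\<^sub>R y) - t * p y"
          using c False by (simp add: pos_divide_le_eq mult.commute)
      qed
      then show ?thesis using c False by (simp add: pos_divide_le_eq mult.commute)
    qed
  qed
  moreover have "q v \<le> p v" for v using q_le[of 0 v] by simp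
  moreover have "q v \<le> p (v + y) - p y" for v using q_le[of 1 v] by simp
  ultimately show thesis using that by blast
qed

text \<open>
  A minimal sublinear function below \<open>p\<close> cannot be lowered in any direction, which by \<open>sublinear_lower\<close> means
  that it is superadditive.
\<close>

lemma linear_below_sublinear:
  fixes p :: "'x::real_vector \<Rightarrow> real"
  assumes p: "sublinear p"
  obtains u where "linear u" "\<And>v. u v \<le> p v"
proof -
  define \<A> where "\<A> = {q. sublinear q \<and> q \<le> p}"
  have "\<exists>m\<in>\<A>. \<forall>q\<in>\<A>. m \<ge> q \<longrightarrow> q = m"
  proof (rule predicate_Zorn)
    show "partial_order_on \<A> (relation_of (\<ge>) \<A>)"
      by (rule partial_order_on_relation_ofI) auto
    fix C assume C: "C \<in> Chains (relation_of (\<ge>) \<A>)"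
    show "\<exists>u\<in>\<A>. \<forall>a\<in>C. u \<le> a"
    proof (cases "C = {}")
      case True
      then show ?thesis using p by (auto simp: \<A>_def)
    next
      case False
      have sub: "C \<subseteq> \<A>" using Chains_relation_of[OF C] .
      have lin: "a \<le> b \<or> b \<le> a" if "a \<in> C" "b \<in> C" for a b
        using C that by (auto simp: Chains_def relation_of_def)
      define q where "q v = (INF a\<in>C. a v)" for v
      have "- p (- v) \<le> a v" if "a \<in> C" for a v
        using sublinear_minus[of a v] sub that le_funD[of a p "- v"] by (fastforce simp: \<A>_def)
      then have bdd: "bdd_below ((\<lambda>a. a v) ` C)" for v by (intro bdd_belowI2) auto
      have q_le: "q v \<le> a v" if "a \<in> C" for a v
        unfolding q_def using bdd that by (intro cINF_lower) auto
      have q_ge: "c \<le> q v" if "\<And>a. a \<in> C \<Longrightarrow> c \<le> a v" for c v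
        unfolding q_def using that False by (intro cINF_greatest) auto
      have "sublinear q"
        unfolding sublinear_def
      proof (intro conjI allI impI)
        fix v w
        have *: "q (v + w) \<le> a v + b w" if ab: "a \<in> C" "b \<in> C" for a b
        proof -
          obtain d where d: "d \<in> C" "d v \<le> a v" "d w \<le> b w"
            using lin[OF ab] ab by (auto simp: le_fun_def)
          have "q (v + w) \<le> d v + d w"
            using q_le[OF d(1), of "v + w"] sublinear_add[of d v w] d(1) sub by (force simp: \<A>_def)
          then show ?thesis using d by linarith
        qed
        have "q (v + w) - b w \<le> q v" if "b \<in> C" for b
          using *[OF _ that] by (intro q_ge) (simp add: algebra_simps)
        then have "q (v + w) - q v \<le> q w" by (intro q_ge) (simp add: algebra_simps)
        then show "q (v + w) \<le> q v + q w" by simp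
      next
        fix c :: real and v assume c: "0 \<le> c"
        have *: "q (c *\<^sub>R v) \<le> c * a v" if "a \<in> C" for a
          using q_le[OF that, of "c *\<^sub>R v"] sublinear_scale_le[of a c v] c sub that
          by (force simp: \<A>_def)
        show "q (c *\<^sub>R v) \<le> c * q v"
        proof (cases "c = 0")
          case True
          then show ?thesis using * False by force
        next
          case False
          have "q (c *\<^sub>R v) / c \<le> q v"
            using * c False by (intro q_ge) (simp add: pos_divide_le_eq mult.commute)
          then show ?thesis using c False by (simp add: pos_divide_le_eq mult.commute)
        qed
      qed
      moreover have "q \<le> p"
      proof -
        obtain a where a: "a \<in> C" using False by blast
        then have "a \<le> p" using sub by (auto simp: \<A>_def)
        then show ?thesis using q_le[OF a] by (auto simp: le_fun_def intro: order_trans)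
      qed
      ultimately show ?thesis
        using q_le by (intro bexI[of _ q]) (auto simp: \<A>_def le_fun_def)
    qed
  qed
  then obtain m where m: "sublinear m" "m \<le> p" and min: "\<And>q. sublinear q \<Longrightarrow> q \<le> p \<Longrightarrow> q \<le> m \<Longrightarrow> q = m"
    by (auto simp: \<A>_def)
  have add: "m (v + y) = m v + m y" for v y
  proof -
    obtain q where q: "sublinear q" "\<And>v. q v \<le> m v" "\<And>v. q v \<le> m (v + y) - m y"
      using sublinear_lower[OF m(1), of y] by blast
    have "q \<le> m" using q(2) by (simp add: le_fun_def)
    then have "q = m" using min q(1) m(2) by (meson order_trans)
    then show ?thesis using q(3)[of v] sublinear_add[OF m(1), of v y] by simp
  qed
  have neg: "m (- v) = - m v" for v
    using add[of v "- v"] sublinear_zero[OF m(1)] by simp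
  have "linear m"
  proof (rule linearI)
    show "m (c *\<^sub>R v) = c *\<^sub>R m v" for c v
    proof (cases "0 \<le> c")
      case True
      then show ?thesis using sublinear_scale[OF m(1)] by simp
    next
      case False
      then have "m ((- c) *\<^sub>R v) = (- c) * m v" by (intro sublinear_scale[OF m(1)]) simp
      then show ?thesis using neg[of "c *\<^sub>R v"] by simp
    qed
  qed (rule add)
  then show thesis using that m(2) by (auto simp: le_fun_def)
qed

text \<open>
  Lowering the norm in the direction of \<open>x\<close> gives a sublinear function with value at most \<open>- norm x\<close> at
  \<open>- x\<close>; every linear function below it is norming at \<open>x\<close>.
\<close>

lemma real_norming_functional:
  fixes x :: "'x::real_normed_vector"
  obtains u :: "'x \<Rightarrow> real" where "linear u" "\<And>v. u v \<le> norm v" "norm x \<le> u x"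
proof -
  have "sublinear (norm :: 'x \<Rightarrow> real)"
    by (auto simp: sublinear_def norm_triangle_ineq)
  then obtain q :: "'x \<Rightarrow> real" where q: "sublinear q" "\<And>v. q v \<le> norm v" "\<And>v. q v \<le> norm (v + x) - norm x"
    using sublinear_lower[of norm x] by blast
  obtain u where u: "linear u" "\<And>v. u v \<le> q v" using linear_below_sublinear[OF q(1)] by blast
  have "u (- x) \<le> - norm x" using u(2)[of "- x"] q(3)[of "- x"] by simp
  then have "norm x \<le> u x" using linear_neg[OF u(1), of x] by simp
  then show thesis using that u q(2) by (meson order_trans)
qed

text \<open>
  The bilinear form \<open>(c * a) \<bullet> 1\<close> on the scalar field is nondegenerate because \<open>inverse a * a = 1\<close>.  It plays the
  role of the real part of the product: it lets a real-linear functional be converted into a linear one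
  without distinguishing real and complex scalars.
\<close>

lemma trace_pairing_representation:
  fixes L :: "'k::{real_normed_field,euclidean_space} \<Rightarrow> real"
  assumes L: "linear L"
  obtains a where "\<And>c. (c * a) \<bullet> 1 = L c"
proof -
  have one: "(1::'k) \<bullet> 1 = 1" using power2_norm_eq_inner[of "1::'k"] by simp
  define A :: "'k \<Rightarrow> 'k" where "A a = (\<Sum>b\<in>Basis. ((b * a) \<bullet> 1) *\<^sub>R b)" for a
  have A_b: "A a \<bullet> b = (b * a) \<bullet> 1" if "b \<in> Basis" for a b
    using that by (simp add: A_def inner_sum_left_Basis)
  have lin: "linear (\<lambda>c. (c * a) \<bullet> 1)" for a :: 'k
    by (rule linearI) (simp_all add: distrib_right inner_add_left)
  have A_lin: "linear A"
    by (rule linearI) (simp_all add: A_def distrib_left inner_add_left scaleR_left_distrib sum.distrib scaleR_right.sum)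
  have det: "(\<lambda>c. (c * a) \<bullet> 1) = L'" if "linear L'" "\<And>b. b \<in> Basis \<Longrightarrow> A a \<bullet> b = L' b" for a L'
    using lin that A_b by (intro linear_eq_stdbasis) auto
  have "inj A"
    unfolding linear_injective_0[OF A_lin]
  proof (intro allI impI)
    fix a assume "A a = 0"
    then have "(\<lambda>c. (c * a) \<bullet> 1) = (\<lambda>_. 0)"
      by (intro det) (auto simp: linear_iff)
    from fun_cong[OF this, of "inverse a"] show "a = 0"
      using one by (cases "a = 0") auto
  qed
  then have "surj A" using A_lin by (intro linear_inj_imp_surj)
  then obtain a where a: "A a = (\<Sum>b\<in>Basis. L b *\<^sub>R b)" by (metis surjD)
  have "(\<lambda>c. (c * a) \<bullet> 1) = L"
    using L by (rule det) (simp add: a inner_sum_left_Basis)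
  then show thesis using that by (metis (full_types))
qed

context normed_space_over
begin

lemma smul_scaleR: "smul (r *\<^sub>R c) x = r *\<^sub>R smul c x"
proof -
  have "r *\<^sub>R c = of_real r * c" by (simp add: scaleR_conv_of_real)
  then show ?thesis by (simp add: smul_of_real flip: scale_scale)
qed

lemma bounded_linear_imp_dual:
  assumes "bounded_linear f" "\<And>c v. f (smul c v) = c * f v"
  shows "Blinfun f \<in> dual_space smul"
proof -
  have "vector_space ((*) :: 'k \<Rightarrow> 'k \<Rightarrow> 'k)" by unfold_locales (auto simp: algebra_simps)
  then show ?thesis
    using assms vector_space_axioms linear_add[OF bounded_linear.linear[OF assms(1)]]
    by (simp add: dual_space_def bounded_linear_Blinfun_apply Vector_Spaces.linear_iff)
qed

lemma dual_space_iff: "f \<in> dual_space smul \<longleftrightarrow> (\<forall>c v. blinfun_apply f (smul c v) = c * blinfun_apply f v)"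
proof
  assume "\<forall>c v. blinfun_apply f (smul c v) = c * blinfun_apply f v"
  then show "f \<in> dual_space smul"
    using bounded_linear_imp_dual[OF blinfun.bounded_linear_right[of f]]
    by (simp add: blinfun_apply_inverse)
qed (simp add: dual_space_def Vector_Spaces.linear_iff)

text \<open>
  With \<open>u\<close> real-linear and norming at \<open>x\<close>, the functional \<open>f\<close> is determined by
  \<open>(c * f v) \<bullet> 1 = u (smul c v)\<close>; over the complex numbers this is \<open>f v = u v - \<i> u (\<i> v)\<close>.
\<close>

lemma dual_norming_functional:
  obtains f where "f \<in> dual_space smul" "norm f \<le> 1" "norm x \<le> norm (blinfun_apply f x)"
proof -
  have one: "(1::'k) \<bullet> 1 = 1" using power2_norm_eq_inner[of "1::'k"] by simp
  obtain u where u: "linear u" "\<And>v. u v \<le> norm v" "norm x \<le> u x"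
    using real_norming_functional[of x] by blast
  have lin: "linear (\<lambda>c. u (smul c v))" for v
    by (rule linearI) (simp_all add: scale_left_distrib linear_add[OF u(1)] smul_scaleR linear_scale[OF u(1)])
  have "\<exists>a. \<forall>c. (c * a) \<bullet> 1 = u (smul c v)" for v
    using trace_pairing_representation[OF lin] by metis
  then obtain f where f: "\<And>v c. (c * f v) \<bullet> 1 = u (smul c v)" by metis
  have uniq: "a = f v" if "\<And>c. (c * a) \<bullet> 1 = u (smul c v)" for a v
  proof (rule ccontr)
    assume "a \<noteq> f v"
    have "(c * (a - f v)) \<bullet> 1 = 0" for c
      using that[of c] f[of c v] by (simp add: right_diff_distrib inner_diff_left)
    from this[of "inverse (a - f v)"] show False using one \<open>a \<noteq> f v\<close> by simp
  qed
  have f_smul: "f (smul c v) = c * f v" for c v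
    by (rule uniq[symmetric]) (use f[of "_ * c" v] in \<open>simp add: mult.assoc\<close>)
  have f_add: "f (v + w) = f v + f w" for v w
    by (rule uniq[symmetric])
      (simp add: distrib_left inner_add_left f scale_right_distrib linear_add[OF u(1)])
  have f_norm: "norm (f v) \<le> norm v" for v
  proof (cases "f v = 0")
    case False
    define c where "c = norm (f v) *\<^sub>R inverse (f v)"
    have "norm c = 1" using False by (simp add: c_def norm_inverse)
    have "norm (f v) = (c * f v) \<bullet> 1" using False one by (simp add: c_def)
    also have "\<dots> \<le> norm (smul c v)" using f u(2) by simp
    also have "\<dots> = norm v" using \<open>norm c = 1\<close> by (simp add: norm_smul)
    finally show ?thesis .
  qed simp
  have f_scaleR: "f (r *\<^sub>R v) = r *\<^sub>R f v" for r v
    using f_smul[of "of_real r" v] by (simp add: smul_of_real scaleR_conv_of_real)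
  have bl: "bounded_linear f"
    by (rule bounded_linear_intro[of _ 1]) (use f_add f_scaleR f_norm in auto)
  show thesis
  proof (rule that)
    show "Blinfun f \<in> dual_space smul" using bl f_smul by (rule bounded_linear_imp_dual)
    show "norm (Blinfun f) \<le> 1"
      by (rule norm_blinfun_bound) (use bl f_norm in \<open>auto simp: bounded_linear_Blinfun_apply\<close>)
    have "norm x \<le> f x \<bullet> 1" using u(3) f[of 1 x] by simp
    also have "\<dots> \<le> norm (f x)" using norm_cauchy_schwarz[of "f x" 1] by simp
    finally show "norm x \<le> norm (blinfun_apply (Blinfun f) x)"
      using bl by (simp add: bounded_linear_Blinfun_apply)
  qed
qed

end

section \<open>Dual spaces and reflexive spaces\<close>

context normed_space_over
begin

lemma subspace_dual_space: "Real_Vector_Spaces.subspace (dual_space smul)"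
  unfolding real_vector.subspace_def
  by (auto simp: dual_space_iff blinfun.zero_left blinfun.add_left blinfun.scaleR_left algebra_simps)

lemma closed_dual_space: "closed (dual_space smul)"
proof -
  have "dual_space smul = (\<Inter>c. \<Inter>v. {f. blinfun_apply f (smul c v) = c * blinfun_apply f v})"
    by (auto simp: dual_space_iff)
  moreover have "closed {f. blinfun_apply f (smul c v) = c * blinfun_apply f v}" for c v
    by (intro closed_Collect_eq continuous_intros)
  ultimately show ?thesis by (simp only:) (intro closed_INT ballI, blast)
qed

lemma bounded_operator_bounded_linear:
  assumes "bounded_operator smul S" shows "bounded_linear S"
proof -
  obtain C where S: "Vector_Spaces.linear smul smul S" and C: "\<And>x. norm (S x) \<le> C * norm x"
    using assms by (auto simp: bounded_operator_def)
  have "S (r *\<^sub>R x) = r *\<^sub>R S x" for r x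
    using S unfolding Vector_Spaces.linear_iff by (metis smul_of_real)
  then show ?thesis
    using S C unfolding Vector_Spaces.linear_iff
    by (intro bounded_linear_intro[of _ C]) (auto simp: mult.commute)
qed

text \<open>
  The limit along an ultrafilter of a bounded sequence of functionals, taken pointwise, is again a
  bounded functional.  This is the theorem of Banach and Alaoglu for sequences.
\<close>

lemma dual_adjoint_system:
  fixes T :: "('v \<Rightarrow>\<^sub>L 'k) \<Rightarrow> ('v \<Rightarrow>\<^sub>L 'k)"
  assumes sep: "separable_space (dual_topology smul)" and T: "adjoint_operator smul T"
  shows "adjoint_system (dual_space smul) T (\<lambda>f y. blinfun_apply f y) UNIV"
proof -
  obtain S where S: "bounded_operator smul S"
    and TS: "\<And>f y. f \<in> dual_space smul \<Longrightarrow> blinfun_apply (T f) y = blinfun_apply f (S y)"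
    using T by (auto simp: adjoint_operator_def)
  obtain C where C: "\<And>y. norm (S y) \<le> C * norm y" using S by (auto simp: bounded_operator_def)
  have S_smul: "S (smul c y) = smul c (S y)" for c y
    using S by (simp add: bounded_operator_def Vector_Spaces.linear_iff)
  show ?thesis
  proof
    show "Real_Vector_Spaces.subspace (dual_space smul)" by (rule subspace_dual_space)
    show "closed (dual_space smul)" by (rule closed_dual_space)
    show "separable_space (dual_topology smul)" by (rule sep)
    show "T f \<in> dual_space smul" if "f \<in> dual_space smul" for f
      using that TS[OF that] by (simp add: dual_space_iff S_smul)
    show "T (f + g) = T f + T g" if "f \<in> dual_space smul" "g \<in> dual_space smul" for f g
      using that real_vector.subspace_add[OF subspace_dual_space that]
      by (intro blinfun_eqI) (simp add: TS blinfun.add_left)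
    show "\<exists>C. \<forall>f\<in>dual_space smul. norm (T f) \<le> C * norm f"
    proof (intro exI ballI)
      fix f assume f: "f \<in> dual_space smul"
      show "norm (T f) \<le> max 0 C * norm f"
      proof (rule norm_blinfun_bound)
        fix y
        have "norm (blinfun_apply (T f) y) \<le> norm f * norm (S y)"
          using TS[OF f] norm_blinfun by metis
        also have "\<dots> \<le> norm f * (max 0 C * norm y)"
          using C[of y] mult_right_mono[of C "max 0 C" "norm y"]
          by (intro mult_left_mono) (auto intro: order_trans)
        finally show "norm (blinfun_apply (T f) y) \<le> max 0 C * norm f * norm y"
          by (simp add: mult_ac)
      qed simp
    qed
    show "blinfun_apply (f - g) y = blinfun_apply f y - blinfun_apply g y" for f g :: "'v \<Rightarrow>\<^sub>L 'k" and y
      by (rule blinfun.diff_left)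
    show "norm (blinfun_apply f y) \<le> norm f * norm y" for f :: "'v \<Rightarrow>\<^sub>L 'k" and y
      by (rule norm_blinfun)
    show "\<exists>y\<in>UNIV. norm y \<le> 1 \<and> r < norm (blinfun_apply f y)" if r: "0 \<le> r" "r < norm f"
      for f :: "'v \<Rightarrow>\<^sub>L 'k" and r
    proof (rule ccontr)
      assume "\<not> ?thesis"
      then have le: "norm (blinfun_apply f y) \<le> r" if "norm y \<le> 1" for y using that by force
      have "norm f \<le> r"
      proof (rule norm_blinfun_bound[OF r(1)])
        fix y
        show "norm (blinfun_apply f y) \<le> r * norm y"
        proof (cases "y = 0")
          case False
          then show ?thesis
            using le[of "y /\<^sub>R norm y"] by (simp add: blinfun.scaleR_right field_simps)
        qed (simp add: blinfun.zero_right)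
      qed
      then show False using r(2) by simp
    qed
    show "\<exists>g\<in>dual_space smul. \<forall>y\<in>UNIV. ((\<lambda>i. blinfun_apply (f i) y) \<longlongrightarrow> blinfun_apply g y) F"
      if F: "ultrafilter F" and f: "\<And>i. f i \<in> dual_space smul" and B: "\<And>i. norm (f i) \<le> B"
      for F :: "nat filter" and f and B
    proof -
      have bound: "norm (blinfun_apply (f i) y) \<le> B * norm y" for i y
        using norm_blinfun[of "f i" y] mult_right_mono[OF B[of i], of "norm y"] by simp
      have "\<exists>l. norm l \<le> B * norm y \<and> ((\<lambda>i. blinfun_apply (f i) y) \<longlongrightarrow> l) F" for y
        using ultrafilter_tendsto_bounded[OF F always_eventually, of "\<lambda>i. blinfun_apply (f i) y"] bound
        by metis
      then obtain l where l: "\<And>y. norm (l y) \<le> B * norm y"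
        "\<And>y. ((\<lambda>i. blinfun_apply (f i) y) \<longlongrightarrow> l y) F" by metis
      note uniq = tendsto_unique[OF ultrafilter_not_bot[OF F]]
      have add: "l (y + z) = l y + l z" for y z
        using uniq[OF l(2)[of "y + z"]] tendsto_add[OF l(2)[of y] l(2)[of z]] by (simp add: blinfun.add_right)
      have scaleR: "l (c *\<^sub>R y) = c *\<^sub>R l y" for c y
        using uniq[OF l(2)[of "c *\<^sub>R y"]] tendsto_scaleR[OF tendsto_const l(2)[of y]]
        by (simp add: blinfun.scaleR_right)
      have smul: "l (smul c y) = c * l y" for c y
        using uniq[OF l(2)[of "smul c y"]] tendsto_mult[OF tendsto_const l(2)[of y]] f
        by (simp add: dual_space_iff)
      have bl: "bounded_linear l"
        by (rule bounded_linear_intro[of _ B]) (use add scaleR l(1) in \<open>auto simp: mult.commute\<close>)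
      show ?thesis
        using bounded_linear_imp_dual[OF bl smul] l(2)
        by (intro bexI[of _ "Blinfun l"]) (auto simp: bounded_linear_Blinfun_apply[OF bl])
    qed
    show "\<exists>y'\<in>UNIV. \<forall>f\<in>dual_space smul. blinfun_apply (T f) y = blinfun_apply f y'" for y
      using TS by blast
  qed
qed

end

text \<open>
  The evaluations at the members of a bounded sequence converge pointwise to a bounded functional on the
  dual space, which by reflexivity is the evaluation at a vector.
\<close>

lemma reflexive_adjoint_system:
  fixes smul :: "'k::{real_normed_field,euclidean_space} \<Rightarrow> 'x::banach \<Rightarrow> 'x"
  assumes "normed_space_over smul"
    and sep: "separable_space (euclidean :: 'x topology)"
    and refl: "reflexive_space smul" and R: "bounded_operator smul R"
  shows "adjoint_system UNIV R (\<lambda>x f. blinfun_apply f x) (dual_space smul)"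
proof -
  interpret normed_space_over smul by fact
  have bl: "bounded_linear R" by (rule bounded_operator_bounded_linear[OF R])
  have R_smul: "R (smul c x) = smul c (R x)" for c x
    using R by (simp add: bounded_operator_def Vector_Spaces.linear_iff)
  show ?thesis
  proof
    show "separable_space (top_of_set (UNIV :: 'x set))" using sep by simp
    show "\<exists>C. \<forall>x\<in>UNIV. norm (R x) \<le> C * norm x" using R by (auto simp: bounded_operator_def)
    show "R (x + y) = R x + R y" for x y using linear_add[OF bounded_linear.linear[OF bl]] .
    show "blinfun_apply f (x - y) = blinfun_apply f x - blinfun_apply f y" for f :: "'x \<Rightarrow>\<^sub>L 'k" and x y
      by (rule blinfun.diff_right)
    show "norm (blinfun_apply f x) \<le> norm x * norm f" for f :: "'x \<Rightarrow>\<^sub>L 'k" and x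
      using norm_blinfun[of f x] by (simp add: mult.commute)
    show "\<exists>f\<in>dual_space smul. norm f \<le> 1 \<and> r < norm (blinfun_apply f x)" if "r < norm x" for x r
      using dual_norming_functional[of x] that by (metis less_le_trans)
    show "\<exists>x\<in>UNIV. \<forall>f\<in>dual_space smul. ((\<lambda>i. blinfun_apply f (s i)) \<longlongrightarrow> blinfun_apply f x) F"
      if F: "ultrafilter F" and B: "\<And>i. norm (s i) \<le> B" for F :: "nat filter" and s :: "nat \<Rightarrow> 'x" and B
    proof -
      have bound: "norm (blinfun_apply f (s i)) \<le> B * norm f" for i and f :: "'x \<Rightarrow>\<^sub>L 'k"
        using norm_blinfun[of f "s i"] mult_left_mono[OF B[of i], of "norm f"] by (simp add: mult.commute)
      have "\<exists>l. norm l \<le> B * norm f \<and> ((\<lambda>i. blinfun_apply f (s i)) \<longlongrightarrow> l) F" for f :: "'x \<Rightarrow>\<^sub>L 'k"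
        using ultrafilter_tendsto_bounded[OF F always_eventually, of "\<lambda>i. blinfun_apply f (s i)"] bound
        by metis
      then obtain \<phi> where \<phi>: "\<And>f. norm (\<phi> f) \<le> B * norm f"
        "\<And>f :: 'x \<Rightarrow>\<^sub>L 'k. ((\<lambda>i. blinfun_apply f (s i)) \<longlongrightarrow> \<phi> f) F" by metis
      note uniq = tendsto_unique[OF ultrafilter_not_bot[OF F]]
      have "\<phi> (f + g) = \<phi> f + \<phi> g" for f g
        using uniq[OF \<phi>(2)[of "f + g"]] tendsto_add[OF \<phi>(2)[of f] \<phi>(2)[of g]] by (simp add: blinfun.add_left)
      moreover have "\<phi> (blinfun_mult_right c o\<^sub>L f) = c * \<phi> f" for c f
        using uniq[OF \<phi>(2)[of "blinfun_mult_right c o\<^sub>L f"]] tendsto_mult[OF tendsto_const \<phi>(2)[of f]]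
        by simp
      ultimately have "bounded_functional_on_dual smul \<phi>"
        using \<phi>(1) unfolding bounded_functional_on_dual_def by blast
      then obtain x where "\<And>f. f \<in> dual_space smul \<Longrightarrow> \<phi> f = blinfun_apply f x"
        using refl by (auto simp: reflexive_space_def)
      then show ?thesis using \<phi>(2) by (metis UNIV_I)
    qed
    show "\<exists>f'\<in>dual_space smul. \<forall>x\<in>UNIV. blinfun_apply f (R x) = blinfun_apply f' x"
      if f: "f \<in> dual_space smul" for f
    proof (intro bexI ballI)
      show "blinfun_apply f (R x) = blinfun_apply (f o\<^sub>L Blinfun R) x" for x
        using bl by (simp add: bounded_linear_Blinfun_apply)
      show "f o\<^sub>L Blinfun R \<in> dual_space smul"
        using f bl by (simp add: dual_space_iff bounded_linear_Blinfun_apply R_smul)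
    qed
  qed auto
qed

theorem theorem5p5:
  fixes scaleY :: "'k::{real_normed_field,euclidean_space} \<Rightarrow> 'y::banach \<Rightarrow> 'y"
    and T :: "('y \<Rightarrow>\<^sub>L 'k) \<Rightarrow> ('y \<Rightarrow>\<^sub>L 'k)"
    and scaleX :: "'k \<Rightarrow> 'x::banach \<Rightarrow> 'x"
    and R :: "'x \<Rightarrow> 'x"
  shows
    "(normed_space_over scaleY \<and> separable_space (dual_topology scaleY) \<and>
      adjoint_operator scaleY T \<and> reiteratively_hypercyclic (dual_topology scaleY) T
      \<longrightarrow> (\<forall>n\<ge>1.
            reiteratively_hypercyclic (power_topology n (dual_topology scaleY)) (direct_sum_power n T) \<and>
            frequently_recurrent (power_topology n (dual_topology scaleY)) (direct_sum_power n T)))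
     \<and>
     (normed_space_over scaleX \<and> separable_space (euclidean :: 'x topology) \<and>
      reflexive_space scaleX \<and> bounded_operator scaleX R \<and>
      reiteratively_hypercyclic (euclidean :: 'x topology) R
      \<longrightarrow> (\<forall>n\<ge>1.
            reiteratively_hypercyclic (power_topology n (euclidean :: 'x topology)) (direct_sum_power n R) \<and>
            frequently_recurrent (power_topology n (euclidean :: 'x topology)) (direct_sum_power n R)))"
proof (intro conjI impI allI)
  fix n :: nat
  assume A: "normed_space_over scaleY \<and> separable_space (dual_topology scaleY) \<and>
      adjoint_operator scaleY T \<and> reiteratively_hypercyclic (dual_topology scaleY) T"
  then interpret adjoint_system "dual_space scaleY" T "\<lambda>f y. blinfun_apply f y" UNIV
    using normed_space_over.dual_adjoint_system by blast
  show "reiteratively_hypercyclic (power_topology n (dual_topology scaleY)) (direct_sum_power n T)"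
    and "frequently_recurrent (power_topology n (dual_topology scaleY)) (direct_sum_power n T)"
    using power_reiteratively_hypercyclic A by blast+
next
  fix n :: nat
  assume A: "normed_space_over scaleX \<and> separable_space (euclidean :: 'x topology) \<and>
      reflexive_space scaleX \<and> bounded_operator scaleX R \<and>
      reiteratively_hypercyclic (euclidean :: 'x topology) R"
  then interpret adjoint_system UNIV R "\<lambda>x f. blinfun_apply f x" "dual_space scaleX"
    using reflexive_adjoint_system by blast
  show "reiteratively_hypercyclic (power_topology n (euclidean :: 'x topology)) (direct_sum_power n R)"
    and "frequently_recurrent (power_topology n (euclidean :: 'x topology)) (direct_sum_power n R)"
    using power_reiteratively_hypercyclic[of n] A by simp_all
qed

end
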